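(* Let $K$ be a field, $G\le \operatorname{PGL}_2(K)$ a finite subgroup and $Q_G=g/h\in K(x)$ a quotient map for $G$. Let $F\in K[x]$ be monic and irreducible. Then there exist a monic irreducible polynomial $r\in K[x]$ with $\deg(F)\mid \deg(r)$ and an integer $k>0$ such that $$F^{Q_G}(x)=\Big(\prod_{t\in G\ast r}t(x)\Big)^k.$$ Moreover, $k=1$ for all but finitely many monic irreducible polynomials $F\in K[x]$.
   Context: For $A=\begin{pmatrix}a&b\\c&d\end{pmatrix}\in\operatorname{GL}_2(K)$ write $[A]$ for its class in $\operatorname{PGL}_2(K)=\operatorname{GL}_2(K)/K^\ast I_2$. The group $\operatorname{PGL}_2(K)$ acts on $\overline{K}\cup\{\infty\}$ by Möbius transformations $[A]\circ v=\frac{av+b}{cv+d}$ (with the usual conventions at $\infty$ and $-d/c$). For a nonzero $f\in K[x]$ set $[A]\ast f(x)=\lambda\,(cx+d)^{\deg f}f\!\left(\frac{ax+b}{cx+d}\right)$, where $\lambda\in K^\ast$ is chosen so that the result is monic; $G\ast r:=\{[A]\ast r:[A]\in G\}$. Let $K(x)^G=\{Q\in K(x): Q([A]\circ x)=Q(x)\ \forall [A]\in G\}$. A quotient map for $G$ is a rational function $Q_G=g/h\in K(x)^G$ with $\gcd(g,h)=1$, $g$ monic and $0\le\deg h<\deg g=|G|$ (it generates $K(x)^G$). For $F=\sum_{i=0}^k a_ix^i\in K[x]$ of degree $k$, the $Q_G$-transform is $F^{Q_G}(x)=h(x)^kF(g(x)/h(x))=\sum_{i=0}^k a_i g(x)^ih(x)^{k-i}$.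 *)

theory Defs
  imports
    "HOL-Analysis.Determinants"
    "HOL-Algebra.Coset"
    "HOL-Computational_Algebra.Polynomial_Factorial"
begin

definition GL2 :: "('a::field ^ 2 ^ 2) monoid" where
  "GL2 = \<lparr>carrier = {A. invertible A}, mult = (**), one = mat 1\<rparr>"

definition scalars2 :: "('a::field ^ 2 ^ 2) set" where
  "scalars2 = {mat c | c. c \<noteq> 0}"

definition PGL2 :: "('a::field ^ 2 ^ 2) set monoid" where
  "PGL2 = GL2 Mod scalars2"

definition pgl_class :: "'a::field ^ 2 ^ 2 \<Rightarrow> ('a ^ 2 ^ 2) set" where
  "pgl_class A = scalars2 #>\<^bsub>GL2\<^esub> A"

definition numer :: "'a::field ^ 2 ^ 2 \<Rightarrow> 'a poly" where
  "numer A = [:A $ 1 $ 2, A $ 1 $ 1:]"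

definition denom :: "'a::field ^ 2 ^ 2 \<Rightarrow> 'a poly" where
  "denom A = [:A $ 2 $ 2, A $ 2 $ 1:]"

text \<open>The field of rational functions over \<open>'a\<close> is \<open>'a poly fract\<close>. First, the value
  of a polynomial at a rational function.\<close>

definition poly_rat :: "'a::field poly \<Rightarrow> 'a poly fract \<Rightarrow> 'a poly fract" where
  "poly_rat p u = poly (map_poly (\<lambda>c. to_fract [:c:]) p) u"

text \<open>The composition \<open>Q(u)\<close>. The description is unique, because a representation of \<open>Q\<close>
  in lowest terms is unique up to a common constant factor; see \<open>rat_compose_Fract\<close>.\<close>

definition rat_compose :: "'a::field poly fract \<Rightarrow> 'a poly fract \<Rightarrow> 'a poly fract" where
  "rat_compose Q u = (THE y. \<exists>p q. q \<noteq> 0 \<and> coprime p q \<and> Q = Fract p q \<and>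
                               y = poly_rat p u / poly_rat q u)"

definition rat_invariants :: "('a::field ^ 2 ^ 2) set set \<Rightarrow> 'a poly fract set" where
  "rat_invariants G =
     {Q. \<forall>A \<in> carrier GL2. pgl_class A \<in> G \<longrightarrow> rat_compose Q (Fract (numer A) (denom A)) = Q}"

definition quotient_map ::
  "('a::field ^ 2 ^ 2) set set \<Rightarrow> 'a poly \<Rightarrow> 'a poly \<Rightarrow> bool" where
  "quotient_map G g h \<longleftrightarrow>
     h \<noteq> 0 \<and> Fract g h \<in> rat_invariants G \<and> coprime g h \<and> lead_coeff g = 1 \<and>
     degree h < degree g \<and> degree g = card G"

text \<open>The polynomial \<open>h ^ degree F * F(g/h)\<close>, written without fractions;
  see \<open>rat_transform_eq\<close>.\<close>

definition rat_transform :: "'a::field poly \<Rightarrow> 'a poly \<Rightarrow> 'a poly \<Rightarrow> 'a poly" where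
  "rat_transform F g h =
     (\<Sum>i\<le>degree F. smult (coeff F i) (g ^ i * h ^ (degree F - i)))"

definition make_monic :: "'a::field poly \<Rightarrow> 'a poly" where
  "make_monic p = smult (inverse (lead_coeff p)) p"

definition star_act :: "'a::field ^ 2 ^ 2 \<Rightarrow> 'a poly \<Rightarrow> 'a poly" where
  "star_act A f = make_monic (rat_transform f (numer A) (denom A))"

definition star_orbit :: "('a::field ^ 2 ^ 2) set set \<Rightarrow> 'a poly \<Rightarrow> 'a poly set" where
  "star_orbit G f = {star_act A f | A. A \<in> carrier GL2 \<and> pgl_class A \<in> G}"


lemma group_GL2: "group (GL2 :: ('a::field ^ 2 ^ 2) monoid)"
proof (rule groupI)
  fix A :: "'a ^ 2 ^ 2"
  assume "A \<in> carrier GL2"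
  then obtain B where "A ** B = mat 1" "B ** A = mat 1"
    by (auto simp: GL2_def invertible_def)
  then show "\<exists>B\<in>carrier GL2. B \<otimes>\<^bsub>GL2\<^esub> A = \<one>\<^bsub>GL2\<^esub>"
    by (auto simp: GL2_def invertible_def intro!: bexI[of _ B])
next
  show "\<one>\<^bsub>GL2\<^esub> \<in> carrier (GL2 :: ('a ^ 2 ^ 2) monoid)"
    unfolding GL2_def invertible_def by (auto intro!: exI[of _ "mat 1"])
qed (simp_all add: GL2_def matrix_mul_assoc invertible_mult)

lemma mat_mult_mat: "mat c ** mat d = (mat (c * d) :: 'a::field ^ 'n ^ 'n)"
  by (vector matrix_matrix_mult_def mat_def)
     (auto simp: if_distrib if_distribR sum.delta' cong: if_cong)

lemma mat_mult_commute: "mat c ** A = A ** (mat c :: 'a::field ^ 'n ^ 'n)"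
  by (simp add: vec_eq_iff matrix_matrix_mult_def mat_def if_distrib if_distribR
        sum.delta sum.delta' mult.commute cong: if_cong)

lemma scalars2_subset: "scalars2 \<subseteq> carrier (GL2 :: ('a::field ^ 2 ^ 2) monoid)"
proof
  fix A :: "'a ^ 2 ^ 2"
  assume "A \<in> scalars2"
  then obtain c where c: "A = mat c" "c \<noteq> 0"
    by (auto simp: scalars2_def)
  then have "A ** mat (inverse c) = mat 1" "mat (inverse c) ** A = mat 1"
    by (simp_all add: mat_mult_mat)
  then show "A \<in> carrier GL2"
    by (auto simp: GL2_def invertible_def)
qed

lemma subgroup_scalars2: "subgroup scalars2 (GL2 :: ('a::field ^ 2 ^ 2) monoid)"
proof (rule group.subgroupI[OF group_GL2 scalars2_subset])
  show "scalars2 \<noteq> ({} :: ('a ^ 2 ^ 2) set)"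
    by (auto simp: scalars2_def intro: exI[of _ 1])
next
  fix A :: "'a ^ 2 ^ 2"
  assume A: "A \<in> scalars2"
  then obtain c where c: "A = mat c" "c \<noteq> 0"
    by (auto simp: scalars2_def)
  have d: "mat (inverse c) \<in> (scalars2 :: ('a ^ 2 ^ 2) set)"
    using c by (auto simp: scalars2_def)
  have "mat (inverse c) \<otimes>\<^bsub>GL2\<^esub> A = \<one>\<^bsub>GL2\<^esub>"
    using c by (simp add: GL2_def mat_mult_mat)
  then have "inv\<^bsub>GL2\<^esub> A = mat (inverse c)"
    using group.inv_equality[OF group_GL2] A d scalars2_subset by blast
  then show "inv\<^bsub>GL2\<^esub> A \<in> scalars2"
    using d by simp
next
  fix A B :: "'a ^ 2 ^ 2"
  assume "A \<in> scalars2" "B \<in> scalars2"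
  then show "A \<otimes>\<^bsub>GL2\<^esub> B \<in> scalars2"
    by (auto simp: scalars2_def GL2_def mat_mult_mat)
qed

lemma normal_scalars2: "scalars2 \<lhd> (GL2 :: ('a::field ^ 2 ^ 2) monoid)"
proof -
  interpret group "GL2 :: ('a ^ 2 ^ 2) monoid"
    by (rule group_GL2)
  show ?thesis
  proof (rule normalI[OF subgroup_scalars2], rule ballI)
    fix A :: "'a ^ 2 ^ 2"
    show "scalars2 #>\<^bsub>GL2\<^esub> A = A <#\<^bsub>GL2\<^esub> scalars2"
      by (force simp: r_coset_def l_coset_def scalars2_def GL2_def mat_mult_commute)
  qed
qed

lemma group_PGL2: "group (PGL2 :: ('a::field ^ 2 ^ 2) set monoid)"
  unfolding PGL2_def by (rule normal.factorgroup_is_group[OF normal_scalars2])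

lemma poly_rat_0 [simp]: "poly_rat 0 u = 0"
  by (simp add: poly_rat_def)

lemma poly_rat_smult: "poly_rat (smult c p) u = to_fract [:c:] * poly_rat p u"
proof -
  have "map_poly (\<lambda>c. to_fract [:c:]) (smult c p) =
          smult (to_fract [:c:]) (map_poly (\<lambda>c. to_fract [:c:]) p)"
    by (rule poly_eqI) (simp add: coeff_map_poly flip: to_fract_mult)
  then show ?thesis
    by (simp add: poly_rat_def)
qed

lemma poly_rat_altdef:
  "poly_rat p u = (\<Sum>i\<le>degree p. to_fract [:coeff p i:] * u ^ i)"
proof -
  have "degree (map_poly (\<lambda>c. to_fract [:c:]) p) = degree p"
    by (intro degree_map_poly) simp
  then show ?thesis
    by (simp add: poly_rat_def poly_altdef coeff_map_poly)
qed

lemma field_poly_bezout: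
  fixes p q :: "'a::field poly"
  shows "\<exists>s t. s * p + t * q dvd p \<and> s * p + t * q dvd q"
proof (induction "if q = 0 then 0 else Suc (degree q)" arbitrary: p q rule: less_induct)
  case less
  show ?case
  proof (cases "q = 0")
    case True
    then show ?thesis
      by (intro exI[of _ 1] exI[of _ 0]) simp
  next
    case False
    have "(if p mod q = 0 then 0 else Suc (degree (p mod q))) <
            (if q = 0 then 0 else Suc (degree q))"
      using False degree_mod_less[of q p] by auto
    from less[OF this] obtain s t
      where st: "s * q + t * (p mod q) dvd q" "s * q + t * (p mod q) dvd p mod q"
      by blast
    have eq: "s * q + t * (p mod q) = t * p + (s - t * (p div q)) * q"
    proof -
      have "p mod q = p - p div q * q"
        by (simp add: minus_div_mult_eq_mod)
      then have "s * q + t * (p mod q) = s * q + t * (p - p div q * q)"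
        by (rule arg_cong)
      also have "\<dots> = t * p + (s - t * (p div q)) * q"
        by (simp only: ring_distribs diff_conv_add_uminus mult_minus_left mult_minus_right ac_simps)
      finally show ?thesis .
    qed
    have "s * q + t * (p mod q) dvd p"
      using st by (rule dvd_mod_imp_dvd[rotated])
    with st(1) show ?thesis
      unfolding eq by blast
  qed
qed

lemma field_poly_coprime_dvd_mult:
  fixes p q r :: "'a::field poly"
  assumes "coprime q p" "q dvd p * r"
  shows "q dvd r"
proof -
  obtain s t where "s * p + t * q dvd p" "s * p + t * q dvd q"
    using field_poly_bezout by blast
  then have "is_unit (s * p + t * q)"
    using assms(1) not_coprimeI by blast
  then obtain u where "1 = (s * p + t * q) * u"
    by blast
  then have "r = (s * p + t * q) * u * r"
    by simp
  also have "\<dots> = s * u * (p * r) + q * (t * u * r)"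
    by (simp add: algebra_simps)
  finally have "r = s * u * (p * r) + q * (t * u * r)" .
  moreover have "q dvd s * u * (p * r) + q * (t * u * r)"
    by (intro dvd_add dvd_mult[OF assms(2)] dvd_triv_left)
  ultimately show ?thesis
    by simp
qed

lemma rat_compose_Fract:
  assumes "q \<noteq> 0" "coprime p q"
  shows "rat_compose (Fract p q) u = poly_rat p u / poly_rat q u"
  unfolding rat_compose_def
proof (rule the_equality)
  show "\<exists>p' q'. q' \<noteq> 0 \<and> coprime p' q' \<and> Fract p q = Fract p' q' \<and>
          poly_rat p u / poly_rat q u = poly_rat p' u / poly_rat q' u"
    using assms by blast
next
  fix y
  assume "\<exists>p' q'. q' \<noteq> 0 \<and> coprime p' q' \<and> Fract p q = Fract p' q' \<and>
            y = poly_rat p' u / poly_rat q' u"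
  then obtain p' q' where *: "q' \<noteq> 0" "coprime p' q'" "Fract p q = Fract p' q'"
      "y = poly_rat p' u / poly_rat q' u"
    by blast
  have eq: "p * q' = p' * q"
    using * assms by (simp add: eq_fract)
  have "q dvd p * q'"
    by (simp add: eq)
  then have "q dvd q'"
    using assms(2) field_poly_coprime_dvd_mult coprime_commute by blast
  have "q' dvd p' * q"
    by (simp flip: eq)
  then have "q' dvd q"
    using *(2) field_poly_coprime_dvd_mult coprime_commute by blast
  obtain s where s: "q' = q * s"
    using \<open>q dvd q'\<close> by blast
  have "q * s dvd q * 1"
    using \<open>q' dvd q\<close> s by simp
  then have "is_unit s"
    using assms(1) by (subst (asm) dvd_mult_cancel_left) auto
  then obtain c where c: "s = [:c:]" "c \<noteq> 0"
    by (metis is_unit_polyE not_is_unit_0 pCons_0_0)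
  have q': "q' = smult c q"
    using s c by simp
  have "p' * q = smult c p * q"
    using eq q' by simp
  then have "p' = smult c p"
    using assms(1) by (simp only: mult_cancel_right) simp
  then show "y = poly_rat p u / poly_rat q u"
    using *(4) q' c by (simp add: poly_rat_smult)
qed

lemma rat_transform_eq:
  assumes "h \<noteq> 0"
  shows "to_fract (rat_transform F g h) = to_fract h ^ degree F * poly_rat F (Fract g h)"
proof -
  have pow: "to_fract (p ^ n) = to_fract p ^ n" for p :: "'a poly" and n
    by (induction n) simp_all
  have sum: "to_fract (sum f A) = (\<Sum>i\<in>A. to_fract (f i))" for f :: "nat \<Rightarrow> 'a poly" and A
    by (induction A rule: infinite_finite_induct) simp_all
  have "to_fract (smult (coeff F i) (g ^ i * h ^ (degree F - i))) =
          to_fract h ^ degree F * (to_fract [:coeff F i:] * Fract g h ^ i)"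
    if "i \<le> degree F" for i
  proof -
    have "smult (coeff F i) (g ^ i * h ^ (degree F - i)) =
            [:coeff F i:] * (g ^ i * h ^ (degree F - i))"
      by simp
    moreover have "to_fract h ^ degree F = to_fract h ^ i * to_fract h ^ (degree F - i)"
      using that by (simp flip: power_add)
    ultimately show ?thesis
      using assms
      by (simp only: to_fract_mult pow Fract_conv_to_fract power_divide) simp
  qed
  then show ?thesis
    unfolding rat_transform_def sum poly_rat_altdef sum_distrib_left
    by (intro sum.cong) auto
qed

end

theory Submission
  imports "HOL-Algebra.Algebraic_Closure_Type" Defs
begin

text \<open>
  Work in the algebraic closure of \<open>K\<close> and put \<open>Q = g/h\<close>. In \<open>y\<close>, the polynomial
  \<open>g(y) h(x) - g(x) h(y)\<close> vanishes at the images \<open>A x\<close> with \<open>A \<in> G\<close>, which for all but finitely many \<open>x\<close>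
  are \<open>|G|\<close> distinct points; so it factors accordingly, and the fibres of \<open>Q\<close> (away from the
  zeros of \<open>h\<close>) are \<open>G\<close>-orbits. If \<open>r\<close> and \<open>s\<close> are irreducible factors of \<open>F\<^sup>Q\<close> with roots \<open>x\<close> and
  \<open>y\<close>, then \<open>Q(x)\<close> and \<open>Q(y)\<close> are conjugate over \<open>K\<close>, hence \<open>x\<close> has a conjugate in the fibre of \<open>y\<close>
  and \<open>s\<close> lies in the orbit of \<open>r\<close>. By invariance of \<open>F\<^sup>Q\<close> all orbit members occur with the same
  multiplicity. The degree of \<open>F\<close> divides that of \<open>r\<close> by the tower law for \<open>K(Q(x)) \<subseteq> K(x)\<close>.

  For the exponent, separability of \<open>F\<close> is not available. Instead, if \<open>x\<close> has \<open>n = |G|\<close> distinct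
  images and the product \<open>M\<close> of the orbit had degree less than \<open>n deg F\<close>, write
  \<open>M = \<Sum>\<^sub>i a\<^sub>i g\<^sup>i h\<^bsup>deg F - 1 - i\<^esup>\<close> with \<open>deg a\<^sub>i < n\<close>. Then \<open>\<Sum>\<^sub>i a\<^sub>i(y) Q(x)\<^sup>i\<close> has \<open>n\<close> roots \<open>y = A x\<close>,
  so it vanishes identically and every \<open>a\<^sub>i\<close> is zero.
\<close>

no_notation fps_nth (infixl "$" 75)

subsection \<open>Evaluation in the algebraic closure\<close>

definition ac_eval :: "'a::field poly \<Rightarrow> 'a alg_closure \<Rightarrow> 'a alg_closure" where
  "ac_eval p x = poly (map_poly to_ac p) x"

lemma degree_map_to_ac [simp]: "degree (map_poly to_ac p) = degree p"
  by (intro degree_map_poly) simp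

lemma map_to_ac_eq_0_iff [simp]: "map_poly to_ac p = 0 \<longleftrightarrow> p = 0"
  by (intro map_poly_eq_0_iff) simp_all

lemma map_to_ac_add: "map_poly to_ac (p + q) = map_poly to_ac p + map_poly to_ac q"
  by (rule poly_eqI) (simp add: coeff_map_poly)

lemma map_to_ac_mult: "map_poly to_ac (p * q) = map_poly to_ac p * map_poly to_ac q"
  by (rule poly_eqI) (simp add: coeff_map_poly coeff_mult to_ac_sum)

lemma ac_eval_0 [simp]: "ac_eval 0 x = 0"
  and ac_eval_1 [simp]: "ac_eval 1 x = 1"
  and ac_eval_pCons [simp]: "ac_eval (pCons c p) x = to_ac c + x * ac_eval p x"
  and ac_eval_add [simp]: "ac_eval (p + q) x = ac_eval p x + ac_eval q x"
  and ac_eval_mult [simp]: "ac_eval (p * q) x = ac_eval p x * ac_eval q x"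
  by (simp_all add: ac_eval_def map_poly_pCons map_to_ac_add map_to_ac_mult)

lemma ac_eval_smult [simp]: "ac_eval (smult c p) x = to_ac c * ac_eval p x"
  using ac_eval_mult[of "[:c:]" p x] by simp

lemma ac_eval_uminus [simp]: "ac_eval (- p) x = - ac_eval p x"
  using ac_eval_smult[of "-1" p x] by simp

lemma ac_eval_diff [simp]: "ac_eval (p - q) x = ac_eval p x - ac_eval q x"
  using ac_eval_add[of p "- q" x] by simp

lemma ac_eval_power [simp]: "ac_eval (p ^ n) x = ac_eval p x ^ n"
  by (induction n) simp_all

lemma ac_eval_sum [simp]: "ac_eval (sum f A) x = (\<Sum>i\<in>A. ac_eval (f i) x)"
  by (induction A rule: infinite_finite_induct) simp_all

lemma ac_eval_prod [simp]: "ac_eval (prod f A) x = (\<Prod>i\<in>A. ac_eval (f i) x)"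
  by (induction A rule: infinite_finite_induct) simp_all

lemma ac_eval_monom [simp]: "ac_eval (monom c n) x = to_ac c * x ^ n"
  by (simp add: ac_eval_def map_poly_monom poly_monom)

lemma ac_eval_altdef:
  assumes "degree p \<le> n"
  shows "ac_eval p x = (\<Sum>i\<le>n. to_ac (coeff p i) * x ^ i)"
  using arg_cong[OF poly_as_sum_of_monoms'[OF assms], of "\<lambda>q. ac_eval q x"] by simp

lemma finite_ac_roots: "p \<noteq> 0 \<Longrightarrow> finite {x. ac_eval p x = 0}"
  unfolding ac_eval_def by (intro poly_roots_finite) simp

lemma ac_root_exists: "degree p > 0 \<Longrightarrow> \<exists>x. ac_eval p x = 0"
  unfolding ac_eval_def by (intro alg_closed_imp_poly_has_root) simp

text \<open>In a finite field, one plus the product of all \<open>[:- a, 1:]\<close> would have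
  positive degree and no root.\<close>

lemma infinite_alg_closed: "infinite (UNIV :: 'a::alg_closed_field set)"
proof
  assume fin: "finite (UNIV :: 'a set)"
  define p :: "'a poly" where "p = 1 + (\<Prod>a\<in>UNIV. [:- a, 1:])"
  have deg: "degree (\<Prod>a\<in>(UNIV :: 'a set). [:- a, 1:]) = card (UNIV :: 'a set)"
    by (subst degree_prod_eq_sum_degree) auto
  have "card (UNIV :: 'a set) > 0"
    using fin by (simp add: card_gt_0_iff)
  then have "degree p > 0"
    unfolding p_def using deg by (subst degree_add_eq_right) auto
  then obtain x where "poly p x = 0"
    using alg_closed_imp_poly_has_root by blast
  moreover have "poly (\<Prod>a\<in>UNIV. [:- a, 1:]) x = 0"
    using fin by (auto simp: poly_prod intro: prod_zero)
  ultimately show False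
    by (simp add: p_def)
qed

lemma poly_eqI_cofinite:
  fixes p q :: "'a::alg_closed_field poly"
  assumes "finite E" "\<And>x. x \<notin> E \<Longrightarrow> poly p x = poly q x"
  shows "p = q"
proof (rule ccontr)
  assume "p \<noteq> q"
  then have "finite {x. poly (p - q) x = 0}"
    by (intro poly_roots_finite) simp
  moreover have "UNIV \<subseteq> {x. poly (p - q) x = 0} \<union> E"
    using assms(2) by auto
  ultimately show False
    using infinite_alg_closed assms(1) by (meson finite_UnI finite_subset)
qed

text \<open>Transforms are compared by their values off the finitely many poles, where fractions can
  be cancelled. Evaluating in the closure, which is infinite, makes this work over finite K
  too.\<close>

lemma eq_if_ac_eval_eq_cofinite:
  assumes "finite E" "\<And>x. x \<notin> E \<Longrightarrow> ac_eval p x = ac_eval q x"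
  shows "p = q"
proof -
  have "map_poly to_ac p = map_poly to_ac q"
    using assms by (intro poly_eqI_cofinite[of E]) (simp_all add: ac_eval_def)
  then have "coeff (map_poly to_ac p) i = coeff (map_poly to_ac q) i" for i
    by simp
  then show ?thesis
    by (intro poly_eqI) (simp add: coeff_map_poly)
qed

lemma coprime_bezout:
  fixes p q :: "'a::field poly"
  assumes "coprime p q"
  obtains s t where "s * p + t * q = 1"
proof -
  obtain s t where "s * p + t * q dvd p" "s * p + t * q dvd q"
    using field_poly_bezout by blast
  then have "s * p + t * q dvd 1"
    using assms not_coprimeI by blast
  then obtain u where "1 = (s * p + t * q) * u"
    by blast
  then have "(u * s) * p + (u * t) * q = 1"
    by (simp add: algebra_simps)
  then show thesis
    by (rule that)
qed

lemma ac_eval_coprime: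
  assumes "coprime p q" "ac_eval p x = 0"
  shows "ac_eval q x \<noteq> 0"
proof -
  obtain s t where "s * p + t * q = 1"
    using coprime_bezout[OF assms(1)] .
  then have "ac_eval (s * p + t * q) x = 1"
    by simp
  then show ?thesis
    using assms(2) by auto
qed

subsection \<open>Minimal polynomials\<close>

definition min_poly_of :: "'a::field poly \<Rightarrow> 'a alg_closure \<Rightarrow> bool" where
  "min_poly_of r x \<longleftrightarrow> lead_coeff r = 1 \<and> irreducible r \<and> ac_eval r x = 0"

lemma irreducible_degree_pos:
  fixes r :: "'a::field poly"
  assumes "irreducible r"
  shows "degree r > 0"
  using assms by (metis irreducible_def is_unit_iff_degree gr_zeroI)

text \<open>A Bezout combination dividing both polynomials is a unit or an associate of
  \<open>r\<close>; in the latter case \<open>r\<close> would divide \<open>p\<close>.\<close>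

lemma irreducible_not_dvd_bezout:
  fixes r p :: "'a::field poly"
  assumes "irreducible r" "\<not> r dvd p"
  shows "\<exists>s t. s * r + t * p = 1"
proof -
  obtain s t where st: "s * r + t * p dvd r" "s * r + t * p dvd p"
    using field_poly_bezout by blast
  then obtain w where w: "r = (s * r + t * p) * w"
    by blast
  have "s * r + t * p dvd 1 \<or> w dvd 1"
    using assms(1) w irreducible_def by blast
  moreover have False if "w dvd 1"
  proof -
    have "r dvd s * r + t * p"
      using that w by (metis dvd_mult_unit_iff dvd_refl)
    then show False
      using st(2) assms(2) dvd_trans by blast
  qed
  ultimately obtain u where "1 = (s * r + t * p) * u"
    by blast
  then have "(u * s) * r + (u * t) * p = 1"
    by (simp add: algebra_simps)
  then show ?thesis
    by blast
qed

lemma min_poly_dvd_iff: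
  assumes "min_poly_of r x"
  shows "ac_eval p x = 0 \<longleftrightarrow> r dvd p"
proof
  assume p: "ac_eval p x = 0"
  show "r dvd p"
  proof (rule ccontr)
    assume "\<not> r dvd p"
    then obtain s t where "s * r + t * p = 1"
      using assms irreducible_not_dvd_bezout unfolding min_poly_of_def by blast
    then have "ac_eval (s * r + t * p) x = 1"
      by simp
    then show False
      using p assms by (simp add: min_poly_of_def)
  qed
next
  assume "r dvd p"
  then show "ac_eval p x = 0"
    using assms by (auto simp: min_poly_of_def)
qed

text \<open>For algebraic \<open>x\<close> the ring K[x] is a field. This is what turns quotients
  such as g(x)/h(x) into values of polynomials at \<open>x\<close>.\<close>

lemma min_poly_inverse:
  assumes "min_poly_of r x" "ac_eval p x \<noteq> 0"
  obtains q where "ac_eval p x * ac_eval q x = 1"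
proof -
  have "\<not> r dvd p"
    using assms min_poly_dvd_iff by blast
  then obtain s t where "s * r + t * p = 1"
    using assms irreducible_not_dvd_bezout unfolding min_poly_of_def by blast
  then have "ac_eval (s * r + t * p) x = 1"
    by simp
  then have "ac_eval p x * ac_eval t x = 1"
    using assms by (simp add: min_poly_of_def mult.commute)
  then show thesis
    by (rule that)
qed

lemma min_poly_eq_of_degree_le:
  assumes "min_poly_of r x" "lead_coeff p = 1" "ac_eval p x = 0" "degree p \<le> degree r"
  shows "p = r"
proof -
  obtain w where w: "p = r * w"
    using min_poly_dvd_iff[OF assms(1)] assms(3) by blast
  have nz: "p \<noteq> 0" "r \<noteq> 0"
    using assms(1,2) by (auto simp: min_poly_of_def)
  then have "w \<noteq> 0"
    using w by auto
  then have "degree w = 0"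
    using w assms(4) nz by (simp add: degree_mult_eq)
  then obtain c where "w = [:c:]"
    by (metis degree_eq_zeroE)
  moreover have "lead_coeff w = 1"
    using w assms(1,2) by (simp add: lead_coeff_mult min_poly_of_def)
  ultimately show ?thesis
    using w by simp
qed

lemma min_poly_unique:
  assumes "min_poly_of r x" "min_poly_of s x"
  shows "r = s"
  using assms by (metis linear min_poly_eq_of_degree_le min_poly_of_def)

text \<open>A nonzero annihilating polynomial of least degree, made monic, is irreducible: one of
  any two factors vanishes at \<open>x\<close>, so it already has full degree and the other one is
  constant.\<close>

lemma min_poly_exists:
  assumes "p \<noteq> 0" "ac_eval p x = 0"
  obtains r where "min_poly_of r x"
proof -
  define P where "P = (\<lambda>q::'a poly. q \<noteq> 0 \<and> ac_eval q x = 0)"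
  define q where "q = arg_min degree P"
  have q: "P q" and min: "\<And>s. P s \<Longrightarrow> degree q \<le> degree s"
    using arg_min_natI[of P p degree] arg_min_nat_le[of P _ degree] assms
    by (auto simp: P_def q_def)
  define r where "r = smult (inverse (lead_coeff q)) q"
  have r: "P r" "lead_coeff r = 1" "degree r = degree q"
    using q by (auto simp: r_def P_def)
  have "irreducible r"
  proof (rule irreducibleI)
    show "r \<noteq> 0"
      using r by auto
    show "\<not> r dvd 1"
    proof
      assume "r dvd 1"
      then have "ac_eval r x \<noteq> 0"
        by (metis ac_eval_1 ac_eval_mult dvdE mult_zero_left zero_neq_one)
      then show False
        using r(1) by (simp add: P_def)
    qed
    fix a b
    assume ab: "r = a * b"
    have nz: "a \<noteq> 0" "b \<noteq> 0"
      using ab r by auto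
    have "P a \<or> P b"
      using ab r(1) by (auto simp: P_def)
    then have "degree r \<le> degree a \<or> degree r \<le> degree b"
      using min r(3) by auto
    then have "degree b = 0 \<or> degree a = 0"
      using ab nz by (auto simp: degree_mult_eq)
    then show "a dvd 1 \<or> b dvd 1"
      using nz by (metis is_unit_iff_degree)
  qed
  then have "min_poly_of r x"
    unfolding min_poly_of_def using r(1,2) by (auto simp: P_def)
  then show thesis
    by (rule that)
qed

subsection \<open>Evaluation of bivariate polynomials\<close>

text \<open>For algebraic \<open>z\<close> every element of K(z) is a polynomial in
  \<open>z\<close>. So polynomials over K(z) are represented by polynomials over K[Z], whose
  coefficients are evaluated at \<open>z\<close>, and no intermediate field has to be built.\<close>

definition ac_eval2 :: "'a::field poly poly \<Rightarrow> 'a alg_closure \<Rightarrow> 'a alg_closure \<Rightarrow> 'a alg_closure" where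
  "ac_eval2 P z x = poly (map_poly (\<lambda>c. ac_eval c z) P) x"

lemma ac_eval2_0 [simp]: "ac_eval2 0 z x = 0"
  and ac_eval2_pCons [simp]: "ac_eval2 (pCons c P) z x = ac_eval c z + x * ac_eval2 P z x"
  by (simp_all add: ac_eval2_def map_poly_pCons)

lemma ac_eval2_add [simp]: "ac_eval2 (P + Q) z x = ac_eval2 P z x + ac_eval2 Q z x"
proof -
  have "map_poly (\<lambda>c. ac_eval c z) (P + Q) = map_poly (\<lambda>c. ac_eval c z) P + map_poly (\<lambda>c. ac_eval c z) Q"
    by (rule poly_eqI) (simp add: coeff_map_poly)
  then show ?thesis
    by (simp add: ac_eval2_def)
qed

lemma ac_eval2_mult [simp]: "ac_eval2 (P * Q) z x = ac_eval2 P z x * ac_eval2 Q z x"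
proof -
  have "map_poly (\<lambda>c. ac_eval c z) (P * Q) = map_poly (\<lambda>c. ac_eval c z) P * map_poly (\<lambda>c. ac_eval c z) Q"
    by (rule poly_eqI) (simp add: coeff_map_poly coeff_mult)
  then show ?thesis
    by (simp add: ac_eval2_def)
qed

lemma ac_eval2_sum [simp]: "ac_eval2 (sum f A) z x = (\<Sum>i\<in>A. ac_eval2 (f i) z x)"
  by (induction A rule: infinite_finite_induct) simp_all

lemma ac_eval2_monom [simp]: "ac_eval2 (monom c n) z x = ac_eval c z * x ^ n"
  by (simp add: ac_eval2_def map_poly_monom poly_monom)

lemma ac_eval2_diff [simp]: "ac_eval2 (P - Q) z x = ac_eval2 P z x - ac_eval2 Q z x"
  using ac_eval2_add[of "P - Q" Q z x] by simp

lemma ac_eval2_altdef: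
  assumes "degree P \<le> n"
  shows "ac_eval2 P z x = (\<Sum>i\<le>n. ac_eval (coeff P i) z * x ^ i)"
  using arg_cong[OF poly_as_sum_of_monoms'[OF assms], of "\<lambda>q. ac_eval2 q z x"] by simp

lemma ac_eval2_map_const [simp]: "ac_eval2 (map_poly (\<lambda>c. [:c:]) p) z x = ac_eval p x"
  by (induction p) (simp_all add: map_poly_pCons)

lemma coeff_sum_monom_lessThan [simp]:
  "coeff (\<Sum>i<n. monom (c i) i) k = (if k < n then c k else 0)"
  by (simp add: coeff_sum)

lemma degree_sum_monom_lessThan: "n > 0 \<Longrightarrow> degree (\<Sum>i<n. monom (c i) i) < n"
  by (rule degree_lessI) auto

text \<open>\<open>m(z, Y)\<close> is the minimal polynomial of \<open>x\<close> over \<open>K(z)\<close>.\<close>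

lemma relative_min_poly_exists:
  assumes "min_poly_of F z" "min_poly_of r x"
  obtains m where "lead_coeff m = 1" "degree m > 0" "ac_eval2 m z x = 0"
    "\<And>P i. degree P < degree m \<Longrightarrow> ac_eval2 P z x = 0 \<Longrightarrow> ac_eval (coeff P i) z = 0"
proof -
  define M where "M = (\<lambda>m::'a poly poly. lead_coeff m = 1 \<and> ac_eval2 m z x = 0)"
  define m where "m = arg_min degree M"
  \<comment> \<open>The minimum is taken over a nonempty set: \<open>r\<close> with constant
    coefficients is a monic annihilator.\<close>
  have "M (map_poly (\<lambda>c. [:c:]) r)"
    using assms(2) by (auto simp: M_def min_poly_of_def coeff_map_poly degree_map_poly)
  then have m: "M m" and min: "\<And>p. M p \<Longrightarrow> degree m \<le> degree p"
    using arg_min_natI[of M _ degree] arg_min_nat_le[of M _ degree] by (auto simp: m_def)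
  have "degree m > 0"
  proof (rule ccontr)
    assume "\<not> degree m > 0"
    then obtain c where "m = [:c:]"
      by (metis degree_eq_zeroE gr_zeroI)
    then show False
      using m by (auto simp: M_def)
  qed
  moreover have "ac_eval (coeff P i) z = 0" if P: "degree P < degree m" "ac_eval2 P z x = 0" for P i
  proof (rule ccontr)
    assume i: "ac_eval (coeff P i) z \<noteq> 0"
    \<comment> \<open>Coefficients of \<open>P\<close> may vanish at \<open>z\<close> without being
      zero. Hence \<open>k\<close> below is the degree after evaluation, which can be smaller than
      \<open>degree P\<close>.\<close>
    define I where "I = {i. ac_eval (coeff P i) z \<noteq> 0}"
    have I: "I \<subseteq> {..degree P}"
      by (auto simp: I_def) (metis ac_eval_0 coeff_eq_0 not_le)
    then have fin: "finite I"
      by (rule finite_subset) simp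
    define k where "k = Max I"
    have k: "k \<in> I" "\<And>j. j \<in> I \<Longrightarrow> j \<le> k"
      using fin i Max_in[OF fin] Max_ge[OF fin] unfolding k_def by (auto simp: I_def)
    obtain c where c: "ac_eval (coeff P k) z * ac_eval c z = 1"
      using k(1) min_poly_inverse[OF assms(1)] by (auto simp: I_def)
    \<comment> \<open>Scaling by \<open>c\<close> makes the top coefficient 1 only after evaluation
      at \<open>z\<close>. Replacing that term by \<open>monom 1 k\<close> gives a polynomial with
      the same value up to the factor c(z) that is literally monic.\<close>
    define p where "p = (\<Sum>j<k. monom (c * coeff P j) j) + monom 1 k"
    have "coeff p k = 1" "\<And>j. j > k \<Longrightarrow> coeff p j = 0"
      by (auto simp: p_def)
    then have deg: "degree p = k" "lead_coeff p = 1"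
      by (metis antisym degree_le le_degree one_neq_zero)+
    have "ac_eval2 p z x = ac_eval c z * (\<Sum>j\<le>k. ac_eval (coeff P j) z * x ^ j)"
      using c by (simp add: p_def flip: lessThan_Suc_atMost)
        (simp add: algebra_simps sum_distrib_left)
    also have "(\<Sum>j\<le>k. ac_eval (coeff P j) z * x ^ j) = (\<Sum>j\<le>degree P. ac_eval (coeff P j) z * x ^ j)"
      using I k by (intro sum.mono_neutral_left) (auto simp: I_def)
    also have "\<dots> = 0"
      using P(2) ac_eval2_altdef[of P "degree P" z x] by simp
    finally have "M p"
      using deg by (simp add: M_def)
    then show False
      using min[of p] deg k(1) I P(1) by auto
  qed
  ultimately show thesis
    using m that by (auto simp: M_def)
qed

text \<open>Pseudo-division by a monic polynomial is ordinary division, so it is available over the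
  coefficient ring K[Z].\<close>

lemma monic_division:
  fixes P m :: "'a::comm_ring_1 poly"
  assumes "lead_coeff m = 1" "degree m > 0"
  obtains q s where "P = m * q + s" "degree s < degree m"
proof -
  obtain q s where qs: "pseudo_divmod P m = (q, s)"
    by (cases "pseudo_divmod P m")
  have "m \<noteq> 0"
    using assms(2) by auto
  then show thesis
    using pseudo_divmod[OF _ qs] assms that[of q s] by auto
qed

text \<open>An embedding of \<open>K(z, x)\<close> into the closure that maps \<open>z\<close> to a given conjugate \<open>z'\<close>.\<close>

lemma conjugate_extend:
  assumes "min_poly_of F z" "min_poly_of F z'" "min_poly_of r x"
  obtains x' where "\<And>P. ac_eval2 P z x = 0 \<Longrightarrow> ac_eval2 P z' x' = 0"
proof -
  obtain m where m: "lead_coeff m = 1" "degree m > 0" "ac_eval2 m z x = 0"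
    "\<And>P i. degree P < degree m \<Longrightarrow> ac_eval2 P z x = 0 \<Longrightarrow> ac_eval (coeff P i) z = 0"
    using relative_min_poly_exists[OF assms(1,3)] by blast
  \<comment> \<open>As \<open>m\<close> is monic, its degree survives evaluation of the coefficients
    at \<open>z'\<close>, so the specialized polynomial has a root.\<close>
  have "degree (map_poly (\<lambda>c. ac_eval c z') m) = degree m"
    using m(1) by (intro map_poly_degree_eq) simp
  then obtain x' where x': "ac_eval2 m z' x' = 0"
    using m(2) alg_closed_imp_poly_has_root[of "map_poly (\<lambda>c. ac_eval c z') m"]
    by (auto simp: ac_eval2_def)
  have "ac_eval2 P z' x' = 0" if P: "ac_eval2 P z x = 0" for P
  proof -
    obtain q s where qs: "P = m * q + s" "degree s < degree m"
      using monic_division[OF m(1,2)] by blast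
    have "ac_eval2 s z x = 0"
      using P qs(1) m(3) by simp
    then have "ac_eval (coeff s i) z = 0" for i
      using m(4) qs(2) by blast
    \<comment> \<open>The coefficients that vanish at \<open>z\<close> are multiples of
      \<open>F\<close>, which is also the minimal polynomial of \<open>z'\<close>.\<close>
    then have "ac_eval (coeff s i) z' = 0" for i
      using min_poly_dvd_iff[OF assms(1)] min_poly_dvd_iff[OF assms(2)] by blast
    then have "ac_eval2 s z' x' = 0"
      by (simp add: ac_eval2_altdef[OF order_refl])
    then show ?thesis
      using qs(1) x' by simp
  qed
  then show thesis
    by (rule that)
qed

section \<open>Linear independence of families and the tower law\<close>

lemma (in vector_space) independent_familyI:
  assumes "finite D" "\<And>c. (\<Sum>i\<in>D. scale (c i) (v i)) = 0 \<Longrightarrow> \<forall>i\<in>D. c i = 0"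
  shows "inj_on v D" "independent (v ` D)"
proof -
  show inj: "inj_on v D"
  proof (rule inj_onI, rule ccontr)
    fix i j
    assume ij: "i \<in> D" "j \<in> D" "v i = v j" "i \<noteq> j"
    \<comment> \<open>If two indices carry the same vector, the difference of their unit
      coefficients is a nontrivial relation.\<close>
    define c where "c = (\<lambda>k. if k = i then 1 else if k = j then - 1 else 0 :: 'a)"
    have "(\<Sum>k\<in>D. scale (c k) (v k)) = (\<Sum>k\<in>{i, j}. scale (c k) (v k))"
      using assms(1) ij by (intro sum.mono_neutral_right) (auto simp: c_def)
    also have "\<dots> = 0"
      using ij by (simp add: c_def)
    finally have "c i = 0"
      using assms(2) ij(1) by blast
    then show False
      by (simp add: c_def)
  qed
  show "independent (v ` D)"
  proof
    assume "dependent (v ` D)"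
    then obtain u where u: "\<exists>w\<in>v ` D. u w \<noteq> 0" "(\<Sum>w\<in>v ` D. scale (u w) w) = 0"
      using dependent_finite[of "v ` D"] assms(1) by auto
    then have "(\<Sum>i\<in>D. scale (u (v i)) (v i)) = 0"
      by (simp add: sum.reindex[OF inj])
    then show False
      using assms(2)[of "\<lambda>i. u (v i)"] u(1) by auto
  qed
qed

text \<open>Tower law by counting: K[x] has as bases over K both the powers of \<open>x\<close>
  below \<open>degree r\<close> and the products of powers of \<open>z\<close> below
  \<open>degree F\<close> with powers of \<open>x\<close> below \<open>degree m\<close>. That
  \<open>z\<close> lies in K[x] keeps the second family inside.\<close>

lemma min_poly_degree_dvd:
  assumes "min_poly_of F z" "min_poly_of r x" "z = ac_eval p x"
  shows "degree F dvd degree r"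
proof -
  interpret vector_space "\<lambda>(c::'a) (x::'a alg_closure). to_ac c * x"
    by unfold_locales (simp_all add: algebra_simps)
  obtain m where m: "lead_coeff m = 1" "degree m > 0" "ac_eval2 m z x = 0"
    "\<And>P i. degree P < degree m \<Longrightarrow> ac_eval2 P z x = 0 \<Longrightarrow> ac_eval (coeff P i) z = 0"
    using relative_min_poly_exists[OF assms(1,2)] by blast
  have degF: "degree F > 0" and degr: "degree r > 0"
    using assms irreducible_degree_pos by (auto simp: min_poly_of_def)
  define T where "T = range (\<lambda>q. ac_eval q x)"
  define D where "D = {..<degree F} \<times> {..<degree m}"
  define v where "v = (\<lambda>(i, j). z ^ i * x ^ j)"
  define w where "w = (\<lambda>j. x ^ j)"
  have T: "subspace T"
  proof (rule subspaceI)
    show "0 \<in> T"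
      unfolding T_def by (rule range_eqI[of _ _ 0]) simp
    fix a b and c :: 'a
    assume "a \<in> T" "b \<in> T"
    then obtain s t where "a = ac_eval s x" "b = ac_eval t x"
      by (auto simp: T_def)
    then show "a + b \<in> T" "to_ac c * a \<in> T"
      unfolding T_def by (auto intro: range_eqI[of _ _ "s + t"] range_eqI[of _ _ "smult c s"])
  qed
  have degree_less: "q = 0" if "min_poly_of s y" "degree q < degree s" "ac_eval q y = 0" for s q y
    using that min_poly_dvd_iff by (metis dvd_imp_degree_le not_le)
  have low: "ac_eval q y \<in> span ((\<lambda>j. y ^ j) ` {..<degree s})" if "min_poly_of s y" for q s y
  proof -
    have s: "s \<noteq> 0" "degree s > 0"
      using that irreducible_degree_pos by (auto simp: min_poly_of_def)
    then have deg: "degree (q mod s) < degree s"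
      using degree_mod_less[of s q] by auto
    have "ac_eval q y = ac_eval (s * (q div s) + q mod s) y"
      by simp
    also have "\<dots> = ac_eval (q mod s) y"
      using that by (simp only: ac_eval_add ac_eval_mult min_poly_of_def) simp
    also have "\<dots> = (\<Sum>j\<le>degree s - 1. to_ac (coeff (q mod s) j) * y ^ j)"
      using deg by (intro ac_eval_altdef) simp
    also have "\<dots> \<in> span ((\<lambda>j. y ^ j) ` {..<degree s})"
      using s by (intro span_sum span_scale span_base) auto
    finally show ?thesis .
  qed
  have spanw: "span (w ` {..<degree r}) = T"
  proof
    have "w j \<in> T" for j
      unfolding T_def w_def by (rule range_eqI[of _ _ "monom 1 j"]) simp
    then show "span (w ` {..<degree r}) \<subseteq> T"
      by (intro span_minimal T) auto
    show "T \<subseteq> span (w ` {..<degree r})"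
      using low[OF assms(2)] by (auto simp: T_def w_def)
  qed
  have spanv: "span (v ` D) = T"
  proof
    have "v ij \<in> T" for ij
      unfolding T_def v_def
      by (cases ij, rule range_eqI[of _ _ "p ^ fst ij * monom 1 (snd ij)"]) (simp add: assms(3))
    then show "span (v ` D) \<subseteq> T"
      by (intro span_minimal T) auto
    show "T \<subseteq> span (v ` D)"
    proof
      fix a
      assume "a \<in> T"
      then obtain q where q: "a = ac_eval q x"
        by (auto simp: T_def)
      obtain q' s where qs: "map_poly (\<lambda>c. [:c:]) q = m * q' + s" "degree s < degree m"
        using monic_division[OF m(1,2)] by blast
      have "a = ac_eval2 (map_poly (\<lambda>c. [:c:]) q) z x"
        using q by simp
      also have "\<dots> = ac_eval2 s z x"
        unfolding qs(1) by (simp add: m(3))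
      also have "\<dots> = (\<Sum>j\<le>degree m - 1. ac_eval (coeff s j) z * x ^ j)"
        using qs(2) by (intro ac_eval2_altdef) simp
      also have "\<dots> \<in> span (v ` D)"
      proof (rule span_sum)
        fix j
        assume "j \<in> {..degree m - 1}"
        then have j: "j < degree m"
          using m(2) by auto
        \<comment> \<open>Since this set of multipliers is a subspace, it contains K[z] as soon as
          it contains the powers of \<open>z\<close> below \<open>degree F\<close>.\<close>
        have sub: "subspace {b. b * x ^ j \<in> span (v ` D)}"
        proof (rule subspaceI; clarify?)
          show "0 * x ^ j \<in> span (v ` D)"
            using span_zero by simp
          fix a b and c :: 'a
          assume ab: "a * x ^ j \<in> span (v ` D)" "b * x ^ j \<in> span (v ` D)"
          show "(a + b) * x ^ j \<in> span (v ` D)"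
            using span_add[OF ab] by (simp add: distrib_right)
          show "to_ac c * a * x ^ j \<in> span (v ` D)"
            using span_scale[OF ab(1), of c] by (simp add: mult.assoc)
        qed
        have "z ^ i * x ^ j \<in> span (v ` D)" if "i < degree F" for i
          using j that by (intro span_base image_eqI[of _ _ "(i, j)"]) (simp_all add: v_def D_def)
        then have "(\<lambda>i. z ^ i) ` {..<degree F} \<subseteq> {b. b * x ^ j \<in> span (v ` D)}"
          by auto
        then have "span ((\<lambda>i. z ^ i) ` {..<degree F}) \<subseteq> {b. b * x ^ j \<in> span (v ` D)}"
          by (rule span_minimal) (rule sub)
        then show "ac_eval (coeff s j) z * x ^ j \<in> span (v ` D)"
          using low[OF assms(1)] by blast
      qed
      finally show "a \<in> span (v ` D)" .
    qed
  qed
  have lw: "\<forall>j\<in>{..<degree r}. c j = 0" if c: "(\<Sum>j<degree r. to_ac (c j) * w j) = 0" for c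
  proof
    fix j
    assume j: "j \<in> {..<degree r}"
    have "(\<Sum>j<degree r. monom (c j) j) = 0"
      using c degr by (intro degree_less[OF assms(2)]) (auto simp: w_def degree_sum_monom_lessThan)
    then have "coeff (\<Sum>j<degree r. monom (c j) j) j = 0"
      by simp
    then show "c j = 0"
      using j by simp
  qed
  have indw: "inj_on w {..<degree r}" "independent (w ` {..<degree r})"
    using independent_familyI[OF finite_lessThan lw] by blast+
  have lv: "\<forall>ij\<in>D. c ij = 0" if c: "(\<Sum>ij\<in>D. to_ac (c ij) * v ij) = 0" for c
  proof
    fix ij
    assume "ij \<in> D"
    then obtain i j where ij: "ij = (i, j)" "i < degree F" "j < degree m"
      by (auto simp: D_def)
    \<comment> \<open>The relation is read as a polynomial in \<open>x\<close> over K[z]: first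
      \<open>m\<close> forces each coefficient \<open>s j\<close> to vanish at \<open>z\<close>,
      then \<open>F\<close> forces \<open>s j\<close> itself to be zero.\<close>
    define s where "s = (\<lambda>j. \<Sum>i<degree F. monom (c (i, j)) i)"
    define P where "P = (\<Sum>j<degree m. monom (s j) j)"
    have "ac_eval2 P z x = (\<Sum>j<degree m. \<Sum>i<degree F. to_ac (c (i, j)) * v (i, j))"
      by (simp add: P_def s_def v_def sum_distrib_right mult.assoc)
    also have "\<dots> = (\<Sum>ij\<in>D. to_ac (c ij) * v ij)"
      unfolding D_def by (subst sum.swap) (simp add: sum.cartesian_product case_prod_unfold)
    finally have "ac_eval2 P z x = 0"
      using c by simp
    moreover have "degree P < degree m"
      unfolding P_def using m(2) by (rule degree_sum_monom_lessThan)
    ultimately have "ac_eval (coeff P j) z = 0"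
      using m(4) by blast
    then have "ac_eval (s j) z = 0"
      using ij by (simp add: P_def)
    then have "s j = 0"
      using degF by (intro degree_less[OF assms(1)]) (simp_all add: s_def degree_sum_monom_lessThan)
    then have "coeff (s j) i = 0"
      by simp
    then show "c ij = 0"
      using ij by (simp add: s_def)
  qed
  have fin: "finite D"
    by (simp add: D_def)
  have indv: "inj_on v D" "independent (v ` D)"
    using independent_familyI[OF fin lv] by blast+
  have "degree r = card (w ` {..<degree r})"
    using indw by (simp add: card_image)
  also have "\<dots> = card (v ` D)"
    using dim_span_eq_card_independent[OF indw(2)] dim_span_eq_card_independent[OF indv(2)]
      spanw spanv by simp
  also have "\<dots> = degree F * degree m"
    using indv by (simp add: card_image D_def)
  finally show ?thesis
    by simp
qed

subsection \<open>Transforms and Moebius transformations\<close>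

lemma ac_eval_rat_transform:
  assumes "ac_eval v y \<noteq> 0"
  shows "ac_eval (rat_transform f u v) y =
           ac_eval v y ^ degree f * ac_eval f (ac_eval u y / ac_eval v y)"
proof -
  have "ac_eval (smult (coeff f i) (u ^ i * v ^ (degree f - i))) y =
          ac_eval v y ^ degree f * (to_ac (coeff f i) * (ac_eval u y / ac_eval v y) ^ i)"
    if "i \<le> degree f" for i
  proof -
    have "ac_eval v y ^ degree f = ac_eval v y ^ i * ac_eval v y ^ (degree f - i)"
      using that by (simp flip: power_add)
    then show ?thesis
      using assms by (simp add: power_divide)
  qed
  then show ?thesis
    unfolding rat_transform_def ac_eval_sum ac_eval_altdef[of f "degree f", OF order_refl]
      sum_distrib_left
    by (intro sum.cong) auto
qed

text \<open>Only the summand with \<open>i = degree f\<close> survives, where the exponent of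
  \<open>v\<close> is zero.\<close>

lemma ac_eval_rat_transform_pole:
  assumes "ac_eval v y = 0"
  shows "ac_eval (rat_transform f u v) y = to_ac (lead_coeff f) * ac_eval u y ^ degree f"
proof -
  have "ac_eval (rat_transform f u v) y =
          (\<Sum>i\<le>degree f. if i = degree f then to_ac (coeff f i) * ac_eval u y ^ i else 0)"
    unfolding rat_transform_def ac_eval_sum
    by (intro sum.cong) (auto simp: assms power_0_left)
  then show ?thesis
    by simp
qed

text \<open>Off the zeros of \<open>v\<close> both sides are the value of \<open>p * q\<close> at
  u/v times a power of \<open>v\<close>. Both factors being nonzero, the degrees and hence these
  exponents add up.\<close>

lemma rat_transform_mult:
  assumes "v \<noteq> 0" "p \<noteq> 0" "q \<noteq> 0"
  shows "rat_transform (p * q) u v = rat_transform p u v * rat_transform q u v"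
  by (rule eq_if_ac_eval_eq_cofinite[OF finite_ac_roots[OF assms(1)]])
    (simp add: ac_eval_rat_transform degree_mult_eq assms power_add)

lemma rat_transform_power:
  assumes "v \<noteq> 0" "p \<noteq> 0"
  shows "rat_transform (p ^ k) u v = rat_transform p u v ^ k"
  by (induction k) (simp_all add: rat_transform_mult assms, simp add: rat_transform_def)

lemma degree_rat_transform_le:
  assumes "degree u \<le> n" "degree v \<le> n"
  shows "degree (rat_transform f u v) \<le> n * degree f"
  unfolding rat_transform_def
proof (rule degree_sum_le)
  fix i
  assume i: "i \<in> {..degree f}"
  have "degree (u ^ i * v ^ (degree f - i)) \<le> degree (u ^ i) + degree (v ^ (degree f - i))"
    by (rule degree_mult_le)
  also have "\<dots> \<le> n * i + n * (degree f - i)"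
    by (intro add_mono order.trans[OF degree_power_le] mult_right_mono assms) simp_all
  also have "\<dots> = n * degree f"
    using i by (simp flip: distrib_left)
  finally show "degree (smult (coeff f i) (u ^ i * v ^ (degree f - i))) \<le> n * degree f"
    by (rule order.trans[OF degree_smult_le])
qed simp

text \<open>The point at infinity is not represented: at a pole the value is the default 0, so the
  facts below ask that \<open>denom A\<close> does not vanish.\<close>

definition moebius :: "'a::field ^ 2 ^ 2 \<Rightarrow> 'a alg_closure \<Rightarrow> 'a alg_closure" where
  "moebius A y = ac_eval (numer A) y / ac_eval (denom A) y"

lemma degree_numer_le: "degree (numer A) \<le> 1"
  and degree_denom_le: "degree (denom A) \<le> 1"
  by (simp_all add: numer_def denom_def)

lemma ac_eval_numer: "ac_eval (numer A) y = to_ac (A $ 1 $ 1) * y + to_ac (A $ 1 $ 2)"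
  and ac_eval_denom: "ac_eval (denom A) y = to_ac (A $ 2 $ 1) * y + to_ac (A $ 2 $ 2)"
  by (simp_all add: numer_def denom_def mult.commute add.commute)

lemma denom_nonzero:
  assumes "invertible A"
  shows "denom A \<noteq> 0"
proof
  assume "denom A = 0"
  then have "det A = 0"
    by (simp add: det_2 denom_def)
  then show False
    using assms by (simp add: invertible_det_nz)
qed

text \<open>In homogeneous coordinates \<open>B\<close> sends (x, 1) to \<open>denom B\<close> at
  \<open>x\<close> times (moebius B x, 1), and \<open>A\<close> sends that vector back to (x,
  1).\<close>

lemma numer_denom_mult:
  assumes "A ** B = mat 1" "ac_eval (denom B) x \<noteq> 0"
  shows "ac_eval (numer A) (moebius B x) = x / ac_eval (denom B) x"
    and "ac_eval (denom A) (moebius B x) = 1 / ac_eval (denom B) x"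
proof -
  have *: "A $ i $ 1 * B $ 1 $ j + A $ i $ 2 * B $ 2 $ j = (if i = j then 1 else 0)" for i j
    using assms(1) by (auto simp: vec_eq_iff matrix_matrix_mult_def sum_2 mat_def)
  have ac: "to_ac (A $ i $ 1) * to_ac (B $ 1 $ j) + to_ac (A $ i $ 2) * to_ac (B $ 2 $ j) =
              (if i = j then 1 else 0)" for i j
    using arg_cong[OF *[of i j], of to_ac] by (simp split: if_splits)
  have ring: "a * (b * u + c) + a' * (b' * u + c') = (a * b + a' * b') * u + (a * c + a' * c')"
    for a b c a' b' c' u :: "'a alg_closure"
    by (simp add: algebra_simps)
  have MD: "moebius B x * ac_eval (denom B) x = ac_eval (numer B) x"
    unfolding moebius_def by (rule nonzero_eq_divide_eq[THEN iffD1, OF assms(2) refl])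
  have M: "(to_ac (A $ i $ 1) * moebius B x + to_ac (A $ i $ 2)) * ac_eval (denom B) x =
             (if i = 1 then x else 1)" for i
  proof -
    have "(to_ac (A $ i $ 1) * moebius B x + to_ac (A $ i $ 2)) * ac_eval (denom B) x =
            to_ac (A $ i $ 1) * ac_eval (numer B) x + to_ac (A $ i $ 2) * ac_eval (denom B) x"
      by (simp only: distrib_right mult.assoc MD)
    also have "\<dots> =
          (to_ac (A $ i $ 1) * to_ac (B $ 1 $ 1) + to_ac (A $ i $ 2) * to_ac (B $ 2 $ 1)) * x +
          (to_ac (A $ i $ 1) * to_ac (B $ 1 $ 2) + to_ac (A $ i $ 2) * to_ac (B $ 2 $ 2))"
      unfolding ac_eval_numer ac_eval_denom by (rule ring)
    finally show ?thesis
      using exhaust_2[of i] unfolding ac by auto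
  qed
  have "ac_eval (numer A) (moebius B x) * ac_eval (denom B) x = x"
    using M[of 1] by (simp add: ac_eval_numer)
  then show "ac_eval (numer A) (moebius B x) = x / ac_eval (denom B) x"
    using assms(2) by (metis nonzero_mult_div_cancel_right)
  have "ac_eval (denom A) (moebius B x) * ac_eval (denom B) x = 1"
    using M[of 2] by (simp add: ac_eval_denom[of A])
  then show "ac_eval (denom A) (moebius B x) = 1 / ac_eval (denom B) x"
    using assms(2) by (metis nonzero_mult_div_cancel_right)
qed

lemma moebius_inverse:
  assumes "A ** B = mat 1" "ac_eval (denom B) x \<noteq> 0"
  shows "ac_eval (denom A) (moebius B x) \<noteq> 0" "moebius A (moebius B x) = x"
  using assms by (simp_all add: moebius_def[of A] numer_denom_mult)

lemma ac_eval_rat_transform_moebius: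
  "ac_eval (denom A) y \<noteq> 0 \<Longrightarrow>
     ac_eval (rat_transform f (numer A) (denom A)) y =
       ac_eval (denom A) y ^ degree f * ac_eval f (moebius A y)"
  by (simp add: ac_eval_rat_transform moebius_def)

text \<open>At the point \<open>moebius B x\<close>, with \<open>B\<close> the inverse of
  \<open>A\<close>, the transform is a nonzero multiple of f(x); if it were zero, \<open>f\<close>
  would vanish at almost all points.\<close>

lemma rat_transform_moebius_nonzero:
  assumes "invertible A" "f \<noteq> 0"
  shows "rat_transform f (numer A) (denom A) \<noteq> 0"
proof
  assume 0: "rat_transform f (numer A) (denom A) = 0"
  obtain B where B: "A ** B = mat 1" "B ** A = mat 1"
    using assms(1) by (auto simp: invertible_def)
  then have "invertible B"
    by (auto simp: invertible_def)
  then have fin: "finite {x. ac_eval (denom B) x = 0}"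
    by (intro finite_ac_roots denom_nonzero)
  have "f = 0"
  proof (rule eq_if_ac_eval_eq_cofinite[OF fin])
    fix x
    assume "x \<notin> {x. ac_eval (denom B) x = 0}"
    then have x: "ac_eval (denom B) x \<noteq> 0"
      by simp
    show "ac_eval f x = ac_eval 0 x"
      using ac_eval_rat_transform_moebius[of A "moebius B x" f] moebius_inverse[OF B(1) x]
      by (simp add: 0)
  qed
  then show False
    using assms(2) by simp
qed

lemma make_monic:
  assumes "p \<noteq> 0"
  shows "lead_coeff (make_monic p) = 1" "degree (make_monic p) = degree p"
    "ac_eval (make_monic p) x = 0 \<longleftrightarrow> ac_eval p x = 0"
  using assms by (simp_all add: make_monic_def)

text \<open>Moebius transforms do not raise degrees. Transforming \<open>r\<close> by
  \<open>A\<close>, and the minimal polynomial \<open>s\<close> of \<open>y\<close> back by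
  \<open>B\<close>, gives degree r \<le> degree s \<le> degree R \<le> degree r, so \<open>R\<close>
  is \<open>s\<close> up to a constant.\<close>

lemma star_act_min_poly:
  assumes "invertible A" "min_poly_of r (moebius A y)" "ac_eval (denom A) y \<noteq> 0"
  shows "min_poly_of (star_act A r) y" "degree (star_act A r) = degree r"
proof -
  obtain B where B: "A ** B = mat 1" "B ** A = mat 1"
    using assms(1) by (auto simp: invertible_def)
  then have invB: "invertible B"
    by (auto simp: invertible_def)
  define R where "R = rat_transform r (numer A) (denom A)"
  have "r \<noteq> 0"
    using assms(2) by (auto simp: min_poly_of_def)
  then have R: "R \<noteq> 0" "ac_eval R y = 0" "degree R \<le> degree r"
    using rat_transform_moebius_nonzero[OF assms(1)] assms(2,3)
      degree_rat_transform_le[OF degree_numer_le degree_denom_le, of r A A]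
    by (simp_all add: R_def ac_eval_rat_transform_moebius min_poly_of_def)
  obtain s where s: "min_poly_of s y"
    using min_poly_exists R(1,2) by blast
  define S where "S = rat_transform s (numer B) (denom B)"
  have "s \<noteq> 0"
    using s by (auto simp: min_poly_of_def)
  moreover have "ac_eval S (moebius A y) = 0"
    using s moebius_inverse[OF B(2) assms(3)]
    by (simp add: S_def ac_eval_rat_transform_moebius min_poly_of_def)
  ultimately have S: "S \<noteq> 0" "r dvd S" "degree S \<le> degree s"
    using rat_transform_moebius_nonzero[OF invB] min_poly_dvd_iff[OF assms(2)]
      degree_rat_transform_le[OF degree_numer_le degree_denom_le, of s B B]
    by (simp_all add: S_def)
  then have "degree r \<le> degree s"
    using dvd_imp_degree_le order.trans by blast
  then have "make_monic R = s"
    using R by (intro min_poly_eq_of_degree_le[OF s make_monic(1)]) (simp_all add: make_monic)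
  then have *: "star_act A r = s"
    by (simp add: star_act_def R_def)
  then show "min_poly_of (star_act A r) y"
    using s by simp
  have "degree s \<le> degree R"
    using min_poly_dvd_iff[OF s] R(1,2) dvd_imp_degree_le by blast
  then show "degree (star_act A r) = degree r"
    using \<open>degree r \<le> degree s\<close> R(3) * by simp
qed

text \<open>The outer coefficients of the identity make the columns of \<open>A\<close> multiples
  \<open>s\<close> and \<open>t\<close> of those of \<open>B\<close>; the middle one says (s - t)
  det B = 0.\<close>

lemma moebius_eq_generic:
  assumes "invertible A" "invertible B" "numer A * denom B = numer B * denom A"
  shows "\<exists>c. c \<noteq> 0 \<and> A = mat c ** B"
proof -
  define a b c d a' b' c' d' where defs: "a = A $ 1 $ 1" "b = A $ 1 $ 2" "c = A $ 2 $ 1" "d = A $ 2 $ 2"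
    "a' = B $ 1 $ 1" "b' = B $ 1 $ 2" "c' = B $ 2 $ 1" "d' = B $ 2 $ 2"
  have det: "a * d - b * c \<noteq> 0" "a' * d' - b' * c' \<noteq> 0"
    using assms(1,2) by (simp_all add: invertible_det_nz det_2 defs)
  have eqs: "a * c' = a' * c" "b * d' = b' * d" "a * d' + b * c' = a' * d + b' * c"
    using assms(3) by (simp_all add: numer_def denom_def defs algebra_simps)
  have col: "\<exists>s. u = s * u' \<and> v = s * v'"
    if "u * v' = u' * v" "u' \<noteq> 0 \<or> v' \<noteq> 0" for u v u' v' :: 'a
  proof (cases "u' = 0")
    case True
    then show ?thesis
      using that by (intro exI[of _ "v / v'"]) auto
  next
    case False
    then show ?thesis
      using that by (intro exI[of _ "u / u'"]) (auto simp: field_simps)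
  qed
  have "a' \<noteq> 0 \<or> c' \<noteq> 0" "b' \<noteq> 0 \<or> d' \<noteq> 0"
    using det(2) by auto
  then obtain s t where s: "a = s * a'" "c = s * c'" and t: "b = t * b'" "d = t * d'"
    using col[OF eqs(1)] col[OF eqs(2)] by blast
  have "(s - t) * (a' * d' - b' * c') = 0"
    using eqs(3) by (simp add: s t algebra_simps)
  then have "s = t"
    using det by simp
  moreover have "s \<noteq> 0"
    using det s by auto
  moreover have "A $ i $ j = s * B $ i $ j" for i j
    using s t \<open>s = t\<close> exhaust_2[of i] exhaust_2[of j] by (auto simp: defs)
  ultimately show ?thesis
    by (intro exI[of _ s])
      (simp add: vec_eq_iff matrix_matrix_mult_def mat_def if_distrib if_distribR cong: if_cong)
qed

subsection \<open>Fibres of the quotient map\<close>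

lemma to_fract_power: "to_fract (p ^ k) = to_fract p ^ k"
  by (induction k) simp_all

lemma hom_pgl_class: "pgl_class \<in> hom GL2 (PGL2 :: ('a::field ^ 2 ^ 2) set monoid)"
  unfolding pgl_class_def[abs_def] PGL2_def by (rule normal.r_coset_hom_Mod[OF normal_scalars2])

lemma carrier_PGL2: "carrier (PGL2 :: ('a::field ^ 2 ^ 2) set monoid) = pgl_class ` carrier GL2"
  by (auto simp: PGL2_def FactGroup_def RCOSETS_def pgl_class_def)

lemma pgl_class_mat_mult:
  fixes B :: "'a::field ^ 2 ^ 2"
  assumes "c \<noteq> 0"
  shows "pgl_class (mat c ** B) = pgl_class B"
proof -
  have "(\<exists>d. d \<noteq> 0 \<and> M = mat d ** (mat c ** B)) \<longleftrightarrow> (\<exists>d. d \<noteq> 0 \<and> M = mat d ** B)" for M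
  proof
    assume "\<exists>d. d \<noteq> 0 \<and> M = mat d ** (mat c ** B)"
    then show "\<exists>d. d \<noteq> 0 \<and> M = mat d ** B"
      using assms by (metis matrix_mul_assoc mat_mult_mat mult_eq_0_iff)
  next
    assume "\<exists>d. d \<noteq> 0 \<and> M = mat d ** B"
    then obtain d where "d \<noteq> 0" "M = mat d ** B"
      by blast
    then show "\<exists>d. d \<noteq> 0 \<and> M = mat d ** (mat c ** B)"
      using assms by (intro exI[of _ "d / c"]) (simp add: matrix_mul_assoc mat_mult_mat)
  qed
  then show ?thesis
    by (auto simp: pgl_class_def r_coset_def scalars2_def GL2_def)
qed

section \<open>The matrices of the subgroup and the invariance of g/h\<close>

locale moebius_quotient =
  fixes G :: "('a::field ^ 2 ^ 2) set set" and g h :: "'a poly"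
  assumes subgroup_G: "subgroup G PGL2" and finite_G: "finite G"
    and quotient: "quotient_map G g h"
begin

definition mats :: "('a ^ 2 ^ 2) set" where
  "mats = {A \<in> carrier GL2. pgl_class A \<in> G}"

lemma star_orbit_eq: "star_orbit G r = (\<lambda>A. star_act A r) ` mats"
  by (auto simp: star_orbit_def mats_def)

lemma invertible_mats: "A \<in> mats \<Longrightarrow> invertible A"
  by (simp add: mats_def GL2_def)

lemma one_in_mats: "mat 1 \<in> mats"
proof -
  interpret group_hom "GL2 :: ('a ^ 2 ^ 2) monoid" PGL2 pgl_class
    by (intro group_hom.intro group_hom_axioms.intro group_GL2 group_PGL2 hom_pgl_class)
  have "pgl_class \<one>\<^bsub>GL2\<^esub> \<in> G"
    using subgroup.one_closed[OF subgroup_G] by simp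
  moreover have "\<one>\<^bsub>GL2\<^esub> = (mat 1 :: 'a ^ 2 ^ 2)"
    by (simp add: GL2_def)
  ultimately show ?thesis
    using G.one_closed by (simp add: mats_def)
qed

lemma inverse_in_mats:
  assumes "A \<in> mats"
  obtains B where "B \<in> mats" "A ** B = mat 1" "B ** A = mat 1"
proof -
  interpret group_hom "GL2 :: ('a ^ 2 ^ 2) monoid" PGL2 pgl_class
    by (intro group_hom.intro group_hom_axioms.intro group_GL2 group_PGL2 hom_pgl_class)
  have A: "A \<in> carrier GL2" "pgl_class A \<in> G"
    using assms by (simp_all add: mats_def)
  then have "pgl_class (inv\<^bsub>GL2\<^esub> A) \<in> G"
    using subgroup.m_inv_closed[OF subgroup_G] by simp
  then have "inv\<^bsub>GL2\<^esub> A \<in> mats"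
    using A by (simp add: mats_def)
  moreover have "A ** (inv\<^bsub>GL2\<^esub> A) = mat 1" "(inv\<^bsub>GL2\<^esub> A) ** A = mat 1"
    using G.r_inv[OF A(1)] G.l_inv[OF A(1)] by (simp_all add: GL2_def)
  ultimately show thesis
    by (rule that)
qed

text \<open>One matrix per class, so that products over \<open>G\<close> become finite products of
  matrix expressions. Unlike \<open>mats\<close>, this set need not be closed under inverses or
  products.\<close>

definition reps :: "('a ^ 2 ^ 2) set" where
  "reps = (\<lambda>C. SOME A. A \<in> carrier GL2 \<and> pgl_class A = C) ` G"

lemma reps: "reps \<subseteq> mats" "finite reps" "card reps = card G" "inj_on pgl_class reps"
proof -
  define \<rho> where "\<rho> = (\<lambda>C. SOME A. A \<in> carrier GL2 \<and> pgl_class A = C :: 'a ^ 2 ^ 2)"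
  have \<rho>: "\<rho> C \<in> carrier GL2 \<and> pgl_class (\<rho> C) = C" if "C \<in> G" for C
  proof -
    have "C \<in> pgl_class ` carrier GL2"
      using that subgroup.subset[OF subgroup_G] carrier_PGL2 by blast
    then have "\<exists>A. A \<in> carrier GL2 \<and> pgl_class A = C"
      by blast
    then show ?thesis
      unfolding \<rho>_def by (rule someI_ex)
  qed
  have reps_eq: "reps = \<rho> ` G"
    by (simp add: reps_def \<rho>_def)
  show "reps \<subseteq> mats" "finite reps"
    using \<rho> finite_G by (auto simp: reps_eq mats_def)
  have "inj_on \<rho> G"
    by (rule inj_on_inverseI[of _ pgl_class]) (simp add: \<rho>)
  then show "card reps = card G"
    by (simp add: reps_eq card_image)
  show "inj_on pgl_class reps"
    by (auto simp: inj_on_def reps_eq \<rho>)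
qed

lemma quotient_facts: "h \<noteq> 0" "coprime g h" "lead_coeff g = 1" "degree h < degree g"
    "degree g = card G" "g \<noteq> 0"
  using quotient by (auto simp: quotient_map_def)

lemma no_common_root: "ac_eval h y = 0 \<Longrightarrow> ac_eval g y \<noteq> 0"
  using ac_eval_coprime quotient_facts(2) by (metis)

text \<open>Clearing denominators in Q(A x) = Q(x) shows that \<open>g\<close> divides its own
  transform, as \<open>g\<close> and \<open>h\<close> are coprime; the degree bound leaves a
  constant cofactor. The extra power of \<open>denom A\<close> appears because \<open>h\<close> is
  homogenized to its own degree, which is below \<open>degree g\<close>.\<close>

lemma invariance:
  assumes "A \<in> mats"
  obtains \<mu> where "\<mu> \<noteq> 0" "rat_transform g (numer A) (denom A) = smult \<mu> g"
    "denom A ^ (degree g - degree h) * rat_transform h (numer A) (denom A) = smult \<mu> h"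
proof -
  define u where "u = Fract (numer A) (denom A)"
  define g' h' where "g' = rat_transform g (numer A) (denom A)"
    and "h' = rat_transform h (numer A) (denom A)"
  have D: "denom A \<noteq> 0"
    using assms invertible_mats denom_nonzero by blast
  have "rat_compose (Fract g h) u = Fract g h"
    using assms quotient by (auto simp: u_def quotient_map_def rat_invariants_def mats_def)
  then have Q: "poly_rat g u / poly_rat h u = to_fract g / to_fract h"
    using rat_compose_Fract[OF quotient_facts(1,2), of u] by (simp only: Fract_conv_to_fract)
  \<comment> \<open>Otherwise division by zero would make the left side of \<open>Q\<close> zero,
    whereas g/h is not zero.\<close>
  have "poly_rat h u \<noteq> 0"
    using Q quotient_facts(1,6) by auto
  then have eq: "poly_rat g u * to_fract h = to_fract g * poly_rat h u"
    using Q quotient_facts(1) by (simp add: frac_eq_eq)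
  have pow: "to_fract (denom A) ^ degree g =
      to_fract (denom A) ^ (degree g - degree h) * to_fract (denom A) ^ degree h"
    using quotient_facts(4) by (simp flip: power_add)
  have tg: "to_fract g' = to_fract (denom A) ^ degree g * poly_rat g u"
    and th: "to_fract h' = to_fract (denom A) ^ degree h * poly_rat h u"
    by (simp_all add: g'_def h'_def u_def rat_transform_eq[OF D])
  have "to_fract (g' * h) = to_fract (denom A) ^ degree g * (poly_rat g u * to_fract h)"
    unfolding to_fract_mult tg by (simp only: mult.assoc)
  also have "\<dots> = to_fract (g * (denom A ^ (degree g - degree h) * h'))"
    unfolding eq pow to_fract_mult th to_fract_power by (simp only: ac_simps)
  finally have *: "g' * h = g * (denom A ^ (degree g - degree h) * h')"
    by (simp only: to_fract_eq_iff)
  have "g dvd h * g'"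
    using * by (metis dvd_triv_left mult.commute)
  then obtain w where w: "g' = g * w"
    using field_poly_coprime_dvd_mult[OF quotient_facts(2)] by blast
  have "g' \<noteq> 0"
    unfolding g'_def
    by (rule rat_transform_moebius_nonzero[OF invertible_mats[OF assms] quotient_facts(6)])
  moreover have "degree g' \<le> degree g"
    using degree_rat_transform_le[OF degree_numer_le degree_denom_le, of g A A]
    by (simp add: g'_def)
  ultimately have "degree w = 0"
    using w by (auto simp: degree_mult_eq)
  then obtain \<mu> where \<mu>: "w = [:\<mu>:]"
    by (metis degree_eq_zeroE)
  show thesis
  proof (rule that)
    show "\<mu> \<noteq> 0"
      using \<open>g' \<noteq> 0\<close> w \<mu> by auto
    show "rat_transform g (numer A) (denom A) = smult \<mu> g"
      using w \<mu> by (simp add: g'_def)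
    have "g * (denom A ^ (degree g - degree h) * h') = g * smult \<mu> h"
      using * w \<mu> by simp
    then show "denom A ^ (degree g - degree h) * rat_transform h (numer A) (denom A) = smult \<mu> h"
      unfolding h'_def by (rule mult_left_cancel[OF quotient_facts(6), THEN iffD1])
  qed
qed

lemma ac_eval_invariance:
  assumes "A \<in> mats"
  obtains \<mu> :: 'a where "\<mu> \<noteq> 0"
    "\<And>y. ac_eval (denom A) y \<noteq> 0 \<Longrightarrow>
       ac_eval (denom A) y ^ degree g * ac_eval g (moebius A y) = to_ac \<mu> * ac_eval g y"
    "\<And>y. ac_eval (denom A) y \<noteq> 0 \<Longrightarrow>
       ac_eval (denom A) y ^ degree g * ac_eval h (moebius A y) = to_ac \<mu> * ac_eval h y"
proof -
  obtain \<mu> where \<mu>: "\<mu> \<noteq> 0" "rat_transform g (numer A) (denom A) = smult \<mu> g"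
    "denom A ^ (degree g - degree h) * rat_transform h (numer A) (denom A) = smult \<mu> h"
    using invariance[OF assms] by blast
  show thesis
  proof (rule that)
    show "\<mu> \<noteq> 0"
      by (rule \<mu>)
    fix y
    assume y: "ac_eval (denom A) y \<noteq> 0"
    show "ac_eval (denom A) y ^ degree g * ac_eval g (moebius A y) = to_ac \<mu> * ac_eval g y"
      using arg_cong[OF \<mu>(2), of "\<lambda>p. ac_eval p y"] y
      by (simp add: ac_eval_rat_transform_moebius)
    have "ac_eval (denom A) y ^ degree g =
        ac_eval (denom A) y ^ (degree g - degree h) * ac_eval (denom A) y ^ degree h"
      using quotient_facts(4) by (simp flip: power_add)
    then show "ac_eval (denom A) y ^ degree g * ac_eval h (moebius A y) = to_ac \<mu> * ac_eval h y"
      using arg_cong[OF \<mu>(3), of "\<lambda>p. ac_eval p y"] y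
      by (simp add: ac_eval_rat_transform_moebius mult.assoc)
  qed
qed

text \<open>Infinity is a pole of Q because \<open>degree h < degree g\<close>, so every point that
  \<open>A\<close> sends to infinity is a pole of Q as well. Algebraically, the positive power of
  \<open>denom A\<close> in \<open>invariance\<close> makes \<open>h\<close> vanish there.\<close>

lemma denom_mats_nonzero:
  assumes "A \<in> mats" "ac_eval h y \<noteq> 0"
  shows "ac_eval (denom A) y \<noteq> 0"
proof
  assume "ac_eval (denom A) y = 0"
  obtain \<mu> where \<mu>: "\<mu> \<noteq> 0"
    "denom A ^ (degree g - degree h) * rat_transform h (numer A) (denom A) = smult \<mu> h"
    using invariance[OF assms(1)] by blast
  have "degree g - degree h > 0"
    using quotient_facts(4) by simp
  then have "to_ac \<mu> * ac_eval h y = 0"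
    using arg_cong[OF \<mu>(2), of "\<lambda>p. ac_eval p y"] \<open>ac_eval (denom A) y = 0\<close>
    by (simp add: power_0_left)
  then show False
    using \<mu>(1) assms(2) by simp
qed

definition qmap :: "'a alg_closure \<Rightarrow> 'a alg_closure" where
  "qmap y = ac_eval g y / ac_eval h y"

lemma qmap_moebius:
  assumes "A \<in> mats" "ac_eval (denom A) y \<noteq> 0" "ac_eval h y \<noteq> 0"
  shows "ac_eval h (moebius A y) \<noteq> 0" "qmap (moebius A y) = qmap y"
proof -
  obtain \<mu> :: 'a where \<mu>: "\<mu> \<noteq> 0"
    "ac_eval (denom A) y ^ degree g * ac_eval g (moebius A y) = to_ac \<mu> * ac_eval g y"
    "ac_eval (denom A) y ^ degree g * ac_eval h (moebius A y) = to_ac \<mu> * ac_eval h y"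
    using ac_eval_invariance[OF assms(1)] assms(2) by metis
  show nz: "ac_eval h (moebius A y) \<noteq> 0"
  proof
    assume "ac_eval h (moebius A y) = 0"
    then have "to_ac \<mu> * ac_eval h y = 0"
      using \<mu>(3) by simp
    then show False
      using \<mu>(1) assms(3) by simp
  qed
  have "qmap (moebius A y) =
      (ac_eval (denom A) y ^ degree g * ac_eval g (moebius A y)) /
      (ac_eval (denom A) y ^ degree g * ac_eval h (moebius A y))"
    using assms(2) by (simp add: qmap_def)
  also have "\<dots> = qmap y"
    unfolding \<mu>(2,3) using \<mu>(1) by (simp add: qmap_def)
  finally show "qmap (moebius A y) = qmap y" .
qed

text \<open>The poles of Q together with the points where two different elements of \<open>G\<close>
  have equal images. Every other point has \<open>card G\<close> distinct finite images.\<close>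

definition exceptional :: "'a alg_closure set" where
  "exceptional = {y. ac_eval h y = 0} \<union>
     (\<Union>A\<in>reps. \<Union>B\<in>reps - {A}. {y. ac_eval (numer A * denom B - numer B * denom A) y = 0})"

lemma finite_exceptional: "finite exceptional"
proof -
  have "numer A * denom B - numer B * denom A \<noteq> 0" if "A \<in> reps" "B \<in> reps - {A}" for A B
  proof
    assume "numer A * denom B - numer B * denom A = 0"
    then have "numer A * denom B = numer B * denom A"
      by simp
    moreover have "A \<in> mats" "B \<in> mats"
      using reps(1) that by auto
    ultimately obtain c where "c \<noteq> 0" "A = mat c ** B"
      using moebius_eq_generic invertible_mats by blast
    then have "pgl_class A = pgl_class B"
      by (simp add: pgl_class_mat_mult)
    then show False
      using reps(4) that by (auto simp: inj_on_def)
  qed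
  then have "finite {y. ac_eval (numer A * denom B - numer B * denom A) y = 0}"
    if "A \<in> reps" "B \<in> reps - {A}" for A B
    using that by (intro finite_ac_roots)
  moreover have "finite {y. ac_eval h y = 0}"
    by (rule finite_ac_roots[OF quotient_facts(1)])
  ultimately show ?thesis
    unfolding exceptional_def using reps(2) by blast
qed

lemma inj_on_moebius:
  assumes "y \<notin> exceptional"
  shows "inj_on (\<lambda>A. moebius A y) reps"
proof (rule inj_onI, rule ccontr)
  fix A B
  assume AB: "A \<in> reps" "B \<in> reps" "moebius A y = moebius B y" "A \<noteq> B"
  have h: "ac_eval h y \<noteq> 0"
    using assms by (auto simp: exceptional_def)
  have "ac_eval (denom A) y \<noteq> 0" "ac_eval (denom B) y \<noteq> 0"
    using AB(1,2) reps(1) denom_mats_nonzero[OF _ h] by blast+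
  then have "ac_eval (numer A * denom B - numer B * denom A) y = 0"
    using AB(3) by (simp add: moebius_def frac_eq_eq)
  then have "y \<in> exceptional"
    using AB(1,2,4) unfolding exceptional_def by blast
  then show False
    using assms by simp
qed

text \<open>For generic \<open>y\<close>, both sides are polynomials in \<open>x\<close> with the \<open>card G\<close> distinct roots
  \<open>moebius A y\<close>; the general case follows since both sides are polynomial in \<open>y\<close>.\<close>

lemma orbit_product:
  "(\<Prod>A\<in>reps. ac_eval (denom A) y) * (ac_eval g x * ac_eval h y - ac_eval g y * ac_eval h x) =
     ac_eval h y * (\<Prod>A\<in>reps. ac_eval (denom A) y * x - ac_eval (numer A) y)"
proof -
  have generic: "(\<Prod>A\<in>reps. ac_eval (denom A) y) * (ac_eval g x * ac_eval h y - ac_eval g y * ac_eval h x) =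
     ac_eval h y * (\<Prod>A\<in>reps. ac_eval (denom A) y * x - ac_eval (numer A) y)"
    if y: "y \<notin> exceptional" for x y
  proof -
    define n where "n = degree g"
    have h: "ac_eval h y \<noteq> 0"
      using y by (auto simp: exceptional_def)
    have D: "ac_eval (denom A) y \<noteq> 0" if "A \<in> reps" for A
      using that reps(1) denom_mats_nonzero[OF _ h] by blast
    define p where "p = smult (ac_eval h y) (map_poly to_ac g) - smult (ac_eval g y) (map_poly to_ac h)"
    define q where "q = smult (ac_eval h y) (\<Prod>A\<in>reps. [:- moebius A y, 1:])"
    have degprod: "degree (\<Prod>A\<in>reps. [:- moebius A y, 1:]) = n"
      by (subst degree_prod_eq_sum_degree) (auto simp: n_def reps quotient_facts)
    moreover have "lead_coeff (\<Prod>A\<in>reps. [:- moebius A y, 1:]) = 1"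
      by (simp add: lead_coeff_prod)
    ultimately have q: "coeff q n = ac_eval h y" "degree q \<le> n"
      by (simp_all add: q_def)
    have "coeff h n = 0"
      using quotient_facts(4) by (simp add: n_def coeff_eq_0)
    then have p: "coeff p n = ac_eval h y"
      using quotient_facts(3) by (simp add: p_def coeff_map_poly n_def)
    have "degree p \<le> n"
      unfolding p_def
      by (intro degree_diff_le order.trans[OF degree_smult_le])
        (use quotient_facts(4) in \<open>simp_all add: n_def\<close>)
    have "p = q"
    \<comment> \<open>Agreement of the coefficients at \<open>n\<close> saves one point:
      \<open>n\<close> common values suffice for degree at most \<open>n\<close>.\<close>
    proof (rule poly_eqI_degree_lead_coeff)
      show "coeff p n = coeff q n" "degree p \<le> n" "degree q \<le> n"
        using p q \<open>degree p \<le> n\<close> by simp_all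
      show "n \<le> card ((\<lambda>A. moebius A y) ` reps)"
        by (simp add: card_image[OF inj_on_moebius[OF y]] reps quotient_facts n_def)
      fix z
      assume "z \<in> (\<lambda>A. moebius A y) ` reps"
      then obtain A where A: "A \<in> reps" "z = moebius A y"
        by blast
      have "A \<in> mats"
        using A reps(1) by blast
      then have "ac_eval h z \<noteq> 0" "qmap z = qmap y"
        using qmap_moebius D[OF A(1)] h A(2) by blast+
      then have "poly p z = 0"
        using h by (simp add: p_def qmap_def frac_eq_eq mult.commute flip: ac_eval_def)
      moreover have "poly q z = 0"
        unfolding q_def poly_smult poly_prod using A reps(2)
        by (simp, intro disjI2) (auto intro!: prod_zero bexI[of _ A])
      ultimately show "poly p z = poly q z"
        by simp
    qed
    then have "poly p x = poly q x"
      by simp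
    then have *: "ac_eval g x * ac_eval h y - ac_eval g y * ac_eval h x =
        ac_eval h y * (\<Prod>A\<in>reps. x - moebius A y)"
      by (simp add: p_def q_def poly_prod mult.commute flip: ac_eval_def)
    have prods: "(\<Prod>A\<in>reps. ac_eval (denom A) y) * (\<Prod>A\<in>reps. x - moebius A y) =
        (\<Prod>A\<in>reps. ac_eval (denom A) y * x - ac_eval (numer A) y)"
      unfolding prod.distrib[symmetric]
      by (intro prod.cong) (simp_all add: D moebius_def right_diff_distrib)
    show ?thesis
      unfolding * prods[symmetric] by (rule mult.left_commute)
  qed
  \<comment> \<open>Now \<open>x\<close> is fixed and \<open>y\<close> is the variable. Multiplying
    by all \<open>denom A\<close> has cleared the poles, so both sides are polynomials in
    \<open>y\<close>.\<close>
  define p where "p = (\<Prod>A\<in>reps. map_poly to_ac (denom A)) *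
      (smult (ac_eval g x) (map_poly to_ac h) - smult (ac_eval h x) (map_poly to_ac g))"
  define q where "q = map_poly to_ac h *
      (\<Prod>A\<in>reps. smult x (map_poly to_ac (denom A)) - map_poly to_ac (numer A))"
  have p: "poly p y = (\<Prod>A\<in>reps. ac_eval (denom A) y) *
      (ac_eval g x * ac_eval h y - ac_eval g y * ac_eval h x)" for y
    by (simp add: p_def poly_prod mult.commute flip: ac_eval_def)
  have q: "poly q y = ac_eval h y * (\<Prod>A\<in>reps. ac_eval (denom A) y * x - ac_eval (numer A) y)" for y
    by (simp add: q_def poly_prod mult.commute flip: ac_eval_def)
  have "p = q"
    using generic by (intro poly_eqI_cofinite[OF finite_exceptional]) (simp add: p q)
  then show ?thesis
    using p q by metis
qed

text \<open>Equal values of Q make the left side of \<open>orbit_product\<close> zero, so some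
  linear factor on the right vanishes.\<close>

lemma qmap_eq_imp_orbit:
  assumes "ac_eval h y \<noteq> 0" "ac_eval h x \<noteq> 0" "qmap x = qmap y"
  obtains A where "A \<in> mats" "x = moebius A y"
proof -
  have "ac_eval g x * ac_eval h y - ac_eval g y * ac_eval h x = 0"
    using assms by (simp add: qmap_def frac_eq_eq)
  then have "ac_eval h y * (\<Prod>A\<in>reps. ac_eval (denom A) y * x - ac_eval (numer A) y) = 0"
    by (simp flip: orbit_product)
  then obtain A where A: "A \<in> reps" "ac_eval (denom A) y * x = ac_eval (numer A) y"
    using assms(1) reps(2) by auto
  then have "A \<in> mats"
    using reps(1) by blast
  moreover have "x = moebius A y"
    using A(2) denom_mats_nonzero[OF \<open>A \<in> mats\<close> assms(1)]
    by (simp add: moebius_def eq_divide_eq mult.commute)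
  ultimately show thesis
    by (rule that)
qed

end

subsection \<open>Factorization of the transform\<close>

text \<open>One factor \<open>p\<close> is removed at a time: it must divide \<open>s\<close>,
  because \<open>w\<close> does not vanish at the root \<open>x\<close> of \<open>p\<close>.\<close>

lemma min_poly_power_dvd_cancel:
  assumes "min_poly_of p x" "ac_eval w x \<noteq> 0" "p ^ k dvd w * s"
  shows "p ^ k dvd s"
  using assms(3)
proof (induction k arbitrary: s)
  case (Suc k)
  have "p dvd w * s"
    using Suc.prems by (meson dvd_power dvd_trans zero_less_Suc)
  then have "p dvd s"
    using min_poly_dvd_iff[OF assms(1)] assms(2) by (metis ac_eval_mult mult_eq_0_iff)
  then obtain s' where s': "s = p * s'"
    by blast
  have "p \<noteq> 0"
    using assms(1) by (auto simp: min_poly_of_def)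
  moreover have "p * p ^ k dvd p * (w * s')"
    using Suc.prems s' by (simp add: mult.left_commute)
  ultimately have "p ^ k dvd w * s'"
    by simp
  then have "p ^ k dvd s'"
    by (rule Suc.IH)
  then show ?case
    by (simp add: s')
qed simp

text \<open>A minimal polynomial does not vanish at a root of a different one, so the powers can be
  split off successively.\<close>

lemma prod_min_polys_power_dvd:
  assumes "finite S" "\<And>p. p \<in> S \<Longrightarrow> \<exists>x. min_poly_of p x" "\<And>p. p \<in> S \<Longrightarrow> p ^ k dvd P"
  shows "(\<Prod>p\<in>S. p) ^ k dvd P"
  using assms
proof (induction S rule: finite_induct)
  case (insert p S)
  obtain x where x: "min_poly_of p x"
    using insert.prems(1) by blast
  have "ac_eval q x \<noteq> 0" if q: "q \<in> S" for q
  proof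
    assume "ac_eval q x = 0"
    moreover obtain y where "min_poly_of q y"
      using insert.prems(1) q by blast
    ultimately have "min_poly_of q x"
      by (simp add: min_poly_of_def)
    then have "q = p"
      using x by (rule min_poly_unique)
    then show False
      using q insert.hyps by simp
  qed
  then have nz: "ac_eval ((\<Prod>p\<in>S. p) ^ k) x \<noteq> 0"
    using insert.hyps by simp
  have "(\<Prod>p\<in>S. p) ^ k dvd P"
    using insert.prems by (intro insert.IH) auto
  then obtain s where s: "P = (\<Prod>p\<in>S. p) ^ k * s"
    by blast
  have "p ^ k dvd (\<Prod>p\<in>S. p) ^ k * s"
    using insert.prems(2)[of p] unfolding s by blast
  then have "p ^ k dvd s"
    by (rule min_poly_power_dvd_cancel[OF x nz])
  then show ?case
    using insert.hyps s by (simp add: power_mult_distrib mult.commute)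
qed simp

lemma smult_power_dvd_iff: "c \<noteq> 0 \<Longrightarrow> smult c p ^ k dvd q \<longleftrightarrow> p ^ k dvd (q :: 'a::field poly)"
  by (simp add: smult_power smult_dvd_iff)

section \<open>Degree, roots and invariance of the transform\<close>

context moebius_quotient
begin

text \<open>Since \<open>degree h < degree g\<close>, only the summand with
  \<open>i = degree F\<close> reaches the top degree.\<close>

lemma transform_monic:
  assumes "lead_coeff F = 1"
  shows "degree (rat_transform F g h) = degree g * degree F" "lead_coeff (rat_transform F g h) = 1"
proof -
  define N where "N = degree g * degree F"
  have "coeff (smult (coeff F i) (g ^ i * h ^ (degree F - i))) N = (if i = degree F then 1 else 0)"
    if i: "i \<le> degree F" for i
  proof (cases "i = degree F")
    case True
    have "coeff (g ^ degree F) N = lead_coeff (g ^ degree F)"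
      using quotient_facts(6) by (simp add: N_def degree_power_eq mult.commute)
    then show ?thesis
      using True assms quotient_facts(3) by (simp add: lead_coeff_power)
  next
    case False
    have "degree (g ^ i * h ^ (degree F - i)) = i * degree g + (degree F - i) * degree h"
      using quotient_facts(1,6) by (simp add: degree_mult_eq degree_power_eq)
    also have "\<dots> < i * degree g + (degree F - i) * degree g"
      using False i quotient_facts(4) by simp
    also have "\<dots> = N"
      using i by (simp add: N_def flip: distrib_right)
    finally show ?thesis
      using False by (simp add: coeff_eq_0)
  qed
  then have "coeff (rat_transform F g h) N = (\<Sum>i\<le>degree F. if i = degree F then 1 else 0)"
    unfolding rat_transform_def coeff_sum by (intro sum.cong) auto
  then have coeff: "coeff (rat_transform F g h) N = 1"
    by simp
  moreover have "degree (rat_transform F g h) \<le> N"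
    unfolding N_def using quotient_facts(4) by (intro degree_rat_transform_le) simp_all
  ultimately have "degree (rat_transform F g h) = N"
    by (metis le_antisym le_degree one_neq_zero)
  then show "degree (rat_transform F g h) = degree g * degree F" "lead_coeff (rat_transform F g h) = 1"
    using coeff by (simp_all add: N_def)
qed

lemma transform_root_iff:
  assumes "lead_coeff F = 1"
  shows "ac_eval (rat_transform F g h) y = 0 \<longleftrightarrow> ac_eval h y \<noteq> 0 \<and> ac_eval F (qmap y) = 0"
proof (cases "ac_eval h y = 0")
  case True
  then show ?thesis
    using assms no_common_root by (simp add: ac_eval_rat_transform_pole)
next
  case False
  then show ?thesis
    by (simp add: ac_eval_rat_transform qmap_def)
qed

text \<open>The transform is \<open>h ^ degree F\<close> times F(Q). The second factor is invariant,
  and \<open>h\<close> is multiplied by a constant up to a power of \<open>denom A\<close>, which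
  the homogenization absorbs.\<close>

lemma transform_invariant:
  assumes "A \<in> mats" "lead_coeff F = 1"
  obtains c where "c \<noteq> 0"
    "rat_transform (rat_transform F g h) (numer A) (denom A) = smult c (rat_transform F g h)"
proof -
  define P where "P = rat_transform F g h"
  obtain \<mu> :: 'a where mu: "\<mu> \<noteq> 0"
    "\<And>y. ac_eval (denom A) y \<noteq> 0 \<Longrightarrow>
       ac_eval (denom A) y ^ degree g * ac_eval h (moebius A y) = to_ac \<mu> * ac_eval h y"
    using ac_eval_invariance[OF assms(1)] by metis
  have "denom A \<noteq> 0"
    using assms(1) invertible_mats denom_nonzero by blast
  then have fin: "finite ({y. ac_eval (denom A) y = 0} \<union> {y. ac_eval h y = 0})"
    using quotient_facts(1) finite_ac_roots by blast
  have "rat_transform P (numer A) (denom A) = smult (\<mu> ^ degree F) P"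
  proof (rule eq_if_ac_eval_eq_cofinite[OF fin])
    fix y
    assume "y \<notin> {y. ac_eval (denom A) y = 0} \<union> {y. ac_eval h y = 0}"
    then have y: "ac_eval (denom A) y \<noteq> 0" "ac_eval h y \<noteq> 0"
      by auto
    have hA: "ac_eval h (moebius A y) \<noteq> 0" and qA: "qmap (moebius A y) = qmap y"
      using qmap_moebius[OF assms(1) y] by blast+
    have "ac_eval (rat_transform P (numer A) (denom A)) y =
        ac_eval (denom A) y ^ (degree g * degree F) * ac_eval P (moebius A y)"
      using y transform_monic[OF assms(2)] by (simp add: ac_eval_rat_transform_moebius P_def)
    also have "ac_eval P (moebius A y) = ac_eval h (moebius A y) ^ degree F * ac_eval F (qmap y)"
      unfolding P_def ac_eval_rat_transform[OF hA] using qA by (simp add: qmap_def)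
    also have "ac_eval (denom A) y ^ (degree g * degree F) * \<dots> =
        (ac_eval (denom A) y ^ degree g * ac_eval h (moebius A y)) ^ degree F * ac_eval F (qmap y)"
      by (simp add: power_mult power_mult_distrib mult.assoc)
    also have "\<dots> = ac_eval (smult (\<mu> ^ degree F) P) y"
      unfolding mu(2)[OF y(1)] using y(2)
      by (simp add: P_def ac_eval_rat_transform qmap_def power_mult_distrib mult.assoc)
    finally show "ac_eval (rat_transform P (numer A) (denom A)) y =
        ac_eval (smult (\<mu> ^ degree F) P) y" .
  qed
  then show thesis
    using mu(1) that[of "\<mu> ^ degree F"] by (simp add: P_def)
qed

text \<open>Transforming a factorization by \<open>A\<close> turns \<open>t ^ k\<close> into the
  power of the transformed \<open>t\<close> and changes the product only by a constant. Hence
  multiplicities do not drop along orbits.\<close>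

lemma star_act_power_dvd_transform:
  assumes "A \<in> mats" "lead_coeff F = 1" "t ^ k dvd rat_transform F g h" "t \<noteq> 0"
  shows "star_act A t ^ k dvd rat_transform F g h"
proof -
  define P where "P = rat_transform F g h"
  have "P \<noteq> 0"
    using transform_monic(2)[OF assms(2)] by (auto simp: P_def)
  moreover obtain s where s: "P = t ^ k * s"
    using assms(3) by (auto simp: P_def)
  ultimately have nz: "t ^ k \<noteq> 0" "s \<noteq> 0"
    by auto
  have inv: "invertible A"
    using assms(1) by (rule invertible_mats)
  define T where "T = rat_transform t (numer A) (denom A)"
  have "T \<noteq> 0"
    unfolding T_def by (rule rat_transform_moebius_nonzero[OF inv assms(4)])
  obtain c where c: "c \<noteq> 0" "rat_transform P (numer A) (denom A) = smult c P"
    using transform_invariant[OF assms(1,2)] by (auto simp: P_def)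
  have "smult c P = rat_transform (t ^ k * s) (numer A) (denom A)"
    using c(2) s by simp
  also have "\<dots> = T ^ k * rat_transform s (numer A) (denom A)"
    using nz assms(4) denom_nonzero[OF inv]
    by (simp add: T_def rat_transform_mult rat_transform_power)
  finally have "T ^ k dvd smult c P"
    by simp
  then have "T ^ k dvd P"
    using c(1) by (rule dvd_smult_cancel)
  then show ?thesis
    using \<open>T \<noteq> 0\<close> by (simp add: star_act_def make_monic_def smult_power_dvd_iff flip: T_def P_def)
qed

text \<open>The action moves roots by the inverse: \<open>B x\<close> is a root of the image of
  \<open>r\<close> under \<open>A\<close> because \<open>A\<close> maps it to
  \<open>x\<close>.\<close>

lemma star_act_orbit:
  assumes "A \<in> mats" "B \<in> mats" "A ** B = mat 1" "B ** A = mat 1"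
    and "min_poly_of r x" "ac_eval h x \<noteq> 0"
  shows "min_poly_of (star_act A r) (moebius B x)" "ac_eval h (moebius B x) \<noteq> 0"
    "qmap (moebius B x) = qmap x" "star_act B (star_act A r) = r"
proof -
  have D: "ac_eval (denom B) x \<noteq> 0"
    by (rule denom_mats_nonzero[OF assms(2,6)])
  show "ac_eval h (moebius B x) \<noteq> 0" "qmap (moebius B x) = qmap x"
    using qmap_moebius[OF assms(2) D assms(6)] by blast+
  show *: "min_poly_of (star_act A r) (moebius B x)"
    using moebius_inverse[OF assms(3) D] assms(1,5)
    by (intro star_act_min_poly(1) invertible_mats) simp_all
  have "min_poly_of (star_act B (star_act A r)) x"
    by (rule star_act_min_poly(1)[OF invertible_mats[OF assms(2)] * D])
  then show "star_act B (star_act A r) = r"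
    using assms(5) by (rule min_poly_unique)
qed

lemma star_orbit_self:
  assumes "min_poly_of r x"
  shows "r \<in> star_orbit G r"
proof -
  have 1: "moebius (mat 1) x = x" "ac_eval (denom (mat 1)) x = 1"
    by (simp_all add: moebius_def ac_eval_numer ac_eval_denom mat_def)
  then have "min_poly_of (star_act (mat 1) r) x"
    using assms one_in_mats by (intro star_act_min_poly(1) invertible_mats) simp_all
  then have "star_act (mat 1) r = r"
    using assms by (rule min_poly_unique)
  then show ?thesis
    unfolding star_orbit_eq using one_in_mats by (metis image_eqI)
qed

lemma star_orbit_root:
  assumes "t \<in> star_orbit G r" "min_poly_of r x" "ac_eval h x \<noteq> 0"
  obtains y where "min_poly_of t y" "ac_eval h y \<noteq> 0" "qmap y = qmap x"
proof -
  obtain A where A: "A \<in> mats" "t = star_act A r"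
    using assms(1) by (auto simp: star_orbit_eq)
  obtain B where "B \<in> mats" "A ** B = mat 1" "B ** A = mat 1"
    using inverse_in_mats[OF A(1)] by blast
  from star_act_orbit[OF A(1) this assms(2,3)] show thesis
    using that A(2) by blast
qed

text \<open>Each member is the minimal polynomial of one of the finitely many roots of the
  transform.\<close>

lemma finite_star_orbit:
  assumes "min_poly_of r x" "ac_eval h x \<noteq> 0" "min_poly_of F (qmap x)"
  shows "finite (star_orbit G r)"
proof -
  define P where "P = rat_transform F g h"
  have F: "lead_coeff F = 1"
    using assms(3) by (simp add: min_poly_of_def)
  then have "P \<noteq> 0"
    using transform_monic(2)[OF F] by (auto simp: P_def)
  then have "finite {y. ac_eval P y = 0}"
    by (rule finite_ac_roots)
  moreover have "star_orbit G r \<subseteq> (\<lambda>y. THE t. min_poly_of t y) ` {y. ac_eval P y = 0}"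
  proof
    fix t
    assume "t \<in> star_orbit G r"
    then obtain y where y: "min_poly_of t y" "ac_eval h y \<noteq> 0" "qmap y = qmap x"
      using star_orbit_root[OF _ assms(1,2)] by blast
    then have "ac_eval P y = 0"
      using assms(3) transform_root_iff[OF F] by (simp add: P_def min_poly_of_def)
    moreover have "(THE t. min_poly_of t y) = t"
      using y(1) min_poly_unique by blast
    ultimately show "t \<in> (\<lambda>y. THE t. min_poly_of t y) ` {y. ac_eval P y = 0}"
      by blast
  qed
  ultimately show ?thesis
    using finite_subset by blast
qed

text \<open>The conjugate of \<open>qmap x\<close> below \<open>y\<close> extends to a conjugate of \<open>x\<close>, which lies in the
  fibre of \<open>y\<close>, that is, in its orbit.\<close>

lemma min_poly_in_star_orbit:
  assumes "min_poly_of F (qmap x)" "min_poly_of F (qmap y)"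
    and "ac_eval h x \<noteq> 0" "ac_eval h y \<noteq> 0" "min_poly_of r x" "min_poly_of s y"
  shows "s \<in> star_orbit G r"
proof -
  obtain x' where x': "\<And>P. ac_eval2 P (qmap x) x = 0 \<Longrightarrow> ac_eval2 P (qmap y) x' = 0"
    using conjugate_extend[OF assms(1,2,5)] by blast
  have "ac_eval2 (map_poly (\<lambda>c. [:c:]) r) (qmap x) x = 0"
    using assms(5) by (simp add: min_poly_of_def)
  then have r: "min_poly_of r x'"
    using x' assms(5) by (fastforce simp: min_poly_of_def)
  \<comment> \<open>The relation g(x) = z h(x) with z = \<open>qmap x\<close>, where
    \<open>[:[:0, 1:]:]\<close> stands for z; it carries over to \<open>x'\<close> with
    \<open>qmap y\<close> in place of z.\<close>
  have "ac_eval2 (map_poly (\<lambda>c. [:c:]) g - [:[:0, 1:]:] * map_poly (\<lambda>c. [:c:]) h) (qmap x) x = 0"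
    using assms(3) by (simp add: qmap_def del: mult_pCons_left)
  from x'[OF this] have gh: "ac_eval g x' = qmap y * ac_eval h x'"
    by (simp del: mult_pCons_left)
  then have h: "ac_eval h x' \<noteq> 0"
    using no_common_root by fastforce
  then have "qmap y = qmap x'"
    using gh by (simp add: qmap_def[of x'])
  then obtain B where B: "B \<in> mats" "y = moebius B x'"
    using qmap_eq_imp_orbit[OF h assms(4)] by blast
  obtain A where "A \<in> mats" "B ** A = mat 1" "A ** B = mat 1"
    using inverse_in_mats[OF B(1)] by blast
  then have "A \<in> mats" "min_poly_of (star_act A r) y"
    using star_act_orbit(1)[OF _ B(1) _ _ r h] B(2) by blast+
  then show ?thesis
    using min_poly_unique[OF assms(6)] by (auto simp: star_orbit_eq)
qed

lemma transform_factorization: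
  assumes "lead_coeff F = 1" "irreducible F"
  shows "\<exists>r k. lead_coeff r = 1 \<and> irreducible r \<and> degree F dvd degree r \<and> k > 0 \<and>
           rat_transform F g h = (\<Prod>t\<in>star_orbit G r. t) ^ k"
proof -
  define P where "P = rat_transform F g h"
  have P: "degree P = degree g * degree F" "lead_coeff P = 1"
    using transform_monic[OF assms(1)] by (simp_all add: P_def)
  have "degree P > 0"
    using P(1) quotient_facts(4) irreducible_degree_pos[OF assms(2)] by simp
  have "P \<noteq> 0"
    using P(2) by auto
  obtain x where x: "ac_eval P x = 0"
    using ac_root_exists[OF \<open>degree P > 0\<close>] by blast
  then have hx: "ac_eval h x \<noteq> 0" and Fx: "min_poly_of F (qmap x)"
    using transform_root_iff[OF assms(1)] assms by (auto simp: P_def min_poly_of_def)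
  obtain r where r: "min_poly_of r x"
    using min_poly_exists[OF \<open>P \<noteq> 0\<close> x] by blast
  have "r \<noteq> 0" "degree r > 0"
    using r irreducible_degree_pos by (auto simp: min_poly_of_def)
  have "r dvd P"
    using min_poly_dvd_iff[OF r] x by simp
  \<comment> \<open>The inverse of h(x) inside K[x] exhibits \<open>qmap x\<close> as a polynomial
    in \<open>x\<close>, as the tower law requires.\<close>
  obtain q where "ac_eval h x * ac_eval q x = 1"
    using min_poly_inverse[OF r hx] .
  then have "qmap x = ac_eval (g * q) x"
    using hx by (simp add: qmap_def divide_eq_eq mult.assoc mult.commute[of "ac_eval q x"])
  then have dvd: "degree F dvd degree r"
    by (rule min_poly_degree_dvd[OF Fx r])

  define \<Omega> where "\<Omega> = star_orbit G r"
  have fin: "finite \<Omega>"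
    unfolding \<Omega>_def by (rule finite_star_orbit[OF r hx Fx])
  have bound: "k \<le> degree P" if "r ^ k dvd P" for k
  proof -
    have "k * 1 \<le> k * degree r"
      using \<open>degree r > 0\<close> by (intro mult_left_mono) simp_all
    also have "\<dots> = degree (r ^ k)"
      using \<open>r \<noteq> 0\<close> by (simp add: degree_power_eq)
    also have "\<dots> \<le> degree P"
      using that \<open>P \<noteq> 0\<close> by (rule dvd_imp_degree_le)
    finally show ?thesis
      by simp
  qed
  \<comment> \<open>The multiplicity of \<open>r\<close> in \<open>P\<close>; the degree bound
    guarantees that the maximum exists.\<close>
  define k where "k = (GREATEST k. r ^ k dvd P)"
  have k: "r ^ k dvd P"
    unfolding k_def by (rule GreatestI_nat[of _ 0 "degree P"]) (use bound in auto)
  have k_max: "j \<le> k" if "r ^ j dvd P" for j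
    unfolding k_def using that by (rule Greatest_le_nat[of _ _ "degree P"]) (use bound in auto)
  have "k > 0"
    using k_max[of 1] \<open>r dvd P\<close> by simp
  have "t ^ k dvd P" if t: "t \<in> \<Omega>" for t
  proof -
    obtain A where "A \<in> mats" "t = star_act A r"
      using t by (auto simp: \<Omega>_def star_orbit_eq)
    then show ?thesis
      using star_act_power_dvd_transform[OF _ assms(1)] k \<open>r \<noteq> 0\<close> by (simp add: P_def)
  qed
  moreover have "\<exists>y. min_poly_of t y" if "t \<in> \<Omega>" for t
    using star_orbit_root[OF _ r hx] that unfolding \<Omega>_def by blast
  ultimately have "(\<Prod>t\<in>\<Omega>. t) ^ k dvd P"
    by (intro prod_min_polys_power_dvd fin)
  then obtain S where S: "P = (\<Prod>t\<in>\<Omega>. t) ^ k * S"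
    by blast
  have "degree S = 0"
  proof (rule ccontr)
    assume "degree S \<noteq> 0"
    then obtain y where y: "ac_eval S y = 0"
      using ac_root_exists by blast
    then have Py: "ac_eval P y = 0"
      by (simp add: S)
    then have hy: "ac_eval h y \<noteq> 0" and Fy: "min_poly_of F (qmap y)"
      using transform_root_iff[OF assms(1)] assms by (auto simp: P_def min_poly_of_def)
    obtain s where s: "min_poly_of s y"
      using min_poly_exists[OF \<open>P \<noteq> 0\<close> Py] by blast
    have "s \<in> \<Omega>"
      unfolding \<Omega>_def by (rule min_poly_in_star_orbit[OF Fx Fy hx hy r s])
    then obtain A where A: "A \<in> mats" "s = star_act A r"
      by (auto simp: \<Omega>_def star_orbit_eq)
    obtain B where B: "B \<in> mats" "A ** B = mat 1" "B ** A = mat 1"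
      using inverse_in_mats[OF A(1)] by blast
    have "s dvd (\<Prod>t\<in>\<Omega>. t)"
      using dvd_prodI[OF fin \<open>s \<in> \<Omega>\<close>, of "\<lambda>t. t"] .
    \<comment> \<open>The root of \<open>S\<close> yields one more factor \<open>s\<close>. Carried
      back to \<open>r\<close> by the inverse matrix \<open>B\<close>, it contradicts the maximality
      of \<open>k\<close>.\<close>
    then have "s ^ k * s dvd (\<Prod>t\<in>\<Omega>. t) ^ k * S"
      using min_poly_dvd_iff[OF s] y by (intro mult_dvd_mono dvd_power_same) simp_all
    then have "s ^ Suc k dvd P"
      by (simp add: S mult.commute)
    moreover have "s \<noteq> 0"
      using s by (auto simp: min_poly_of_def)
    ultimately have "star_act B s ^ Suc k dvd P"
      using star_act_power_dvd_transform[OF B(1) assms(1)] unfolding P_def by blast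
    then have "r ^ Suc k dvd P"
      using star_act_orbit(4)[OF A(1) B r hx] A(2) by simp
    then show False
      using k_max[of "Suc k"] by simp
  qed
  then obtain c where c: "S = [:c:]"
    by (metis degree_eq_zeroE)
  have "lead_coeff t = 1" if "t \<in> \<Omega>" for t
    using star_orbit_root[OF _ r hx] that unfolding \<Omega>_def by (auto simp: min_poly_of_def)
  then have "lead_coeff (\<Prod>t\<in>\<Omega>. t) = 1"
    by (simp add: lead_coeff_prod)
  then have "lead_coeff S = 1"
    using P(2) unfolding S lead_coeff_mult lead_coeff_power by simp
  then have "P = (\<Prod>t\<in>\<Omega>. t) ^ k"
    using S c by simp
  then show ?thesis
    using r dvd \<open>k > 0\<close> unfolding P_def \<Omega>_def min_poly_of_def by blast
qed

end

subsection \<open>Multiplicity one\<close>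

text \<open>This is the expansion of \<open>M\<close> in base \<open>g\<close>, homogenized by
  powers of \<open>h\<close>. The lowest digit is fixed modulo \<open>g\<close>, where
  \<open>h\<close> is invertible, and the rest follows by induction.\<close>

lemma two_base_expansion:
  fixes g h M :: "'a::field poly"
  assumes "coprime h g" "degree h < degree g" "degree M < degree g * f"
  shows "\<exists>a. (\<forall>i<f. degree (a i) < degree g) \<and> M = (\<Sum>i<f. a i * g ^ i * h ^ (f - 1 - i))"
  using assms(3)
proof (induction f arbitrary: M)
  case (Suc f)
  show ?case
  proof (cases "f = 0")
    case True
    then show ?thesis
      using Suc.prems by (intro exI[of _ "\<lambda>_. M"]) simp
  next
    case False
    have "g \<noteq> 0"
      using assms(2) by auto
    obtain s t where st: "s * h + t * g = 1"
      using coprime_bezout[OF assms(1)] .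
    \<comment> \<open>Modulo \<open>g\<close> the polynomial \<open>s\<close> is the inverse of
      \<open>h\<close>, so this digit solves M = a0 h^f modulo \<open>g\<close>.\<close>
    define a0 where "a0 = (M * s ^ f) mod g"
    have deg_a0: "degree a0 < degree g"
      unfolding a0_def using degree_mod_less[of g "M * s ^ f"] \<open>g \<noteq> 0\<close> assms(2) by auto
    have "g dvd (s * h) ^ f - 1 ^ f"
    proof -
      have "g dvd s * h - 1"
        using st by (metis dvd_triv_right dvd_minus_iff minus_diff_eq add_diff_cancel_left')
      then show ?thesis
        by (metis power_diff_sumr2 dvd_mult2)
    qed
    then have "g dvd M * ((s * h) ^ f - 1)"
      by simp
    moreover have "g dvd (M * s ^ f - a0) * h ^ f"
      unfolding a0_def by (simp add: minus_mod_eq_mult_div)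
    ultimately have "g dvd (M * s ^ f - a0) * h ^ f - M * ((s * h) ^ f - 1)"
      by (rule dvd_diff[rotated])
    also have "(M * s ^ f - a0) * h ^ f - M * ((s * h) ^ f - 1) = M - a0 * h ^ f"
      by (simp add: power_mult_distrib algebra_simps)
    finally obtain M' where M': "M - a0 * h ^ f = g * M'"
      by blast
    have "degree (a0 * h ^ f) \<le> degree a0 + f * degree h"
      using degree_mult_le[of a0 "h ^ f"] degree_power_le[of h f] by (simp add: mult.commute)
    also have "\<dots> < degree g + f * degree g"
      using deg_a0 assms(2) by (intro add_less_le_mono mult_le_mono2) simp_all
    also have "\<dots> = degree g * Suc f"
      by simp
    finally have "degree (g * M') < degree g * Suc f"
      unfolding M'[symmetric] using Suc.prems by (intro degree_diff_less)
    \<comment> \<open>For \<open>M' = 0\<close> this needs a positive right side, which is why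
      \<open>f = 0\<close> was treated separately.\<close>
    then have "degree M' < degree g * f"
      using \<open>g \<noteq> 0\<close> False assms(2) by (cases "M' = 0") (auto simp: degree_mult_eq)
    then obtain a where a: "\<forall>i<f. degree (a i) < degree g"
      "M' = (\<Sum>i<f. a i * g ^ i * h ^ (f - 1 - i))"
      using Suc.IH by blast
    define b where "b = (\<lambda>i. case i of 0 \<Rightarrow> a0 | Suc j \<Rightarrow> a j)"
    have "M = a0 * h ^ f + g * M'"
      using M' by (simp add: algebra_simps)
    also have "\<dots> = (\<Sum>i<Suc f. b i * g ^ i * h ^ (Suc f - 1 - i))"
      unfolding sum.lessThan_Suc_shift a(2) sum_distrib_left
      by (simp add: b_def algebra_simps)
    finally have "M = (\<Sum>i<Suc f. b i * g ^ i * h ^ (Suc f - 1 - i))" .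
    moreover have "\<forall>i<Suc f. degree (b i) < degree g"
      using a(1) deg_a0 by (auto simp: b_def split: nat.splits)
    ultimately show ?thesis
      by blast
  qed
qed simp

context moebius_quotient
begin

text \<open>The values \<open>moebius A x\<close> are \<open>degree g\<close> distinct conjugates of \<open>x\<close> over \<open>K(qmap x)\<close>, so
  the product of the orbit has degree at least \<open>degree g * degree F\<close>.\<close>

lemma orbit_multiplicity_le_1:
  assumes F: "min_poly_of F (qmap x)" and r: "min_poly_of r x" and x: "x \<notin> exceptional"
    and eq: "rat_transform F g h = (\<Prod>t\<in>star_orbit G r. t) ^ k"
  shows "k \<le> 1"
proof (rule ccontr)
  assume "\<not> k \<le> 1"
  define M where "M = (\<Prod>t\<in>star_orbit G r. t)"
  define f where "f = degree F"
  define n where "n = degree g"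
  have "f > 0" "n > 0" and F1: "lead_coeff F = 1"
    using F irreducible_degree_pos quotient_facts(4) by (auto simp: f_def n_def min_poly_of_def)
  have hx: "ac_eval h x \<noteq> 0"
    using x by (auto simp: exceptional_def)
  have fin: "finite (star_orbit G r)"
    by (rule finite_star_orbit[OF r hx F])
  have "M \<noteq> 0"
    using transform_monic(2)[OF F1] eq \<open>\<not> k \<le> 1\<close> by (auto simp: M_def power_0_left)
  then have deg: "k * degree M = n * f"
    using transform_monic(1)[OF F1] eq by (simp add: degree_power_eq n_def f_def flip: M_def)
  then have "degree M > 0"
    using \<open>f > 0\<close> \<open>n > 0\<close> by (metis gr0I mult_0_right nat_0_less_mult_iff)
  then have "1 * degree M < k * degree M"
    using \<open>\<not> k \<le> 1\<close> by (intro mult_strict_right_mono) auto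
  then have "degree M < n * f"
    using deg by simp
  then obtain a where a: "\<forall>i<f. degree (a i) < n" "M = (\<Sum>i<f. a i * g ^ i * h ^ (f - 1 - i))"
    using two_base_expansion[of h g M f] quotient_facts(2,4) by (auto simp: coprime_commute n_def)
  \<comment> \<open>This is \<open>M\<close> divided by \<open>h ^ (f - 1)\<close> with Q(y) frozen
    to the constant Q(x). On the images of \<open>x\<close>, where Q has this value and
    \<open>M\<close> vanishes, \<open>w\<close> vanishes too.\<close>
  define w where "w = (\<Sum>i<f. smult (qmap x ^ i) (map_poly to_ac (a i)))"
  have "w = 0"
  proof (rule poly_eqI_degree)
    show "card ((\<lambda>A. moebius A x) ` reps) > degree (0 :: 'a alg_closure poly)"
      using \<open>n > 0\<close> by (simp add: card_image[OF inj_on_moebius[OF x]] reps quotient_facts n_def)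
    have "degree w \<le> n - 1"
      unfolding w_def using a(1) \<open>n > 0\<close>
      by (intro degree_sum_le order.trans[OF degree_smult_le]) fastforce+
    then show "card ((\<lambda>A. moebius A x) ` reps) > degree w"
      using \<open>n > 0\<close> by (simp add: card_image[OF inj_on_moebius[OF x]] reps quotient_facts n_def)
    fix y
    assume "y \<in> (\<lambda>A. moebius A x) ` reps"
    then obtain B where B: "B \<in> mats" "y = moebius B x"
      using reps(1) by blast
    obtain A where A: "A \<in> mats" "B ** A = mat 1" "A ** B = mat 1"
      using inverse_in_mats[OF B(1)] by blast
    note orbit = star_act_orbit[OF A(1) B(1) A(3,2) r hx, folded B(2)]
    have "star_act A r \<in> star_orbit G r"
      using A(1) by (auto simp: star_orbit_eq)
    then have "ac_eval M y = 0"
      using fin orbit(1) by (auto simp: M_def min_poly_of_def intro!: prod_zero)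
    moreover have "ac_eval M y = ac_eval h y ^ (f - 1) * poly w y"
    proof -
      have "ac_eval (a i * g ^ i * h ^ (f - 1 - i)) y =
          ac_eval h y ^ (f - 1) * poly (smult (qmap x ^ i) (map_poly to_ac (a i))) y"
        if "i < f" for i
      proof -
        have "ac_eval h y ^ (f - 1) = ac_eval h y ^ i * ac_eval h y ^ (f - 1 - i)"
          using that by (simp flip: power_add)
        moreover have "ac_eval g y = qmap x * ac_eval h y"
          using orbit(2,3) by (metis qmap_def nonzero_divide_eq_eq)
        ultimately show ?thesis
          by (simp add: power_mult_distrib flip: ac_eval_def)
      qed
      then show ?thesis
        unfolding a(2) ac_eval_sum w_def poly_sum sum_distrib_left by (intro sum.cong) auto
    qed
    ultimately show "poly w y = poly 0 y"
      using orbit(2) by simp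
  qed
  have "a i = 0" if "i < f" for i
  proof (rule poly_eqI)
    fix j
    \<comment> \<open>A fixed coefficient of \<open>w\<close> is a polynomial in
      \<open>qmap x\<close> over K of degree below \<open>degree F\<close>, so it is zero only if
      all its coefficients are.\<close>
    define p where "p = (\<Sum>i<f. monom (coeff (a i) j) i)"
    have "ac_eval p (qmap x) = coeff w j"
      by (simp add: p_def w_def coeff_sum coeff_map_poly mult.commute)
    then have "F dvd p"
      using \<open>w = 0\<close> min_poly_dvd_iff[OF F] by simp
    moreover have "degree p < degree F"
      unfolding p_def using \<open>f > 0\<close> by (simp add: degree_sum_monom_lessThan f_def)
    ultimately have "p = 0"
      using dvd_imp_degree_le not_le by blast
    then have "coeff p i = 0"
      by simp
    then show "coeff (a i) j = coeff 0 j"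
      using that by (simp add: p_def)
  qed
  then show False
    using a(2) \<open>M \<noteq> 0\<close> by simp
qed

text \<open>An exponent other than 1 forces every root of \<open>r\<close> to be exceptional, and
  such a root \<open>x\<close> determines \<open>F\<close> as the minimal polynomial of
  \<open>qmap x\<close>.\<close>

lemma finite_multiplicity_not_1:
  "finite {F. lead_coeff F = 1 \<and> irreducible F \<and>
     (\<exists>r k. lead_coeff r = 1 \<and> irreducible r \<and> degree F dvd degree r \<and> (k::nat) > 0 \<and>
            rat_transform F g h = (\<Prod>t\<in>star_orbit G r. t) ^ k \<and> k \<noteq> 1)}"
  (is "finite ?S")
proof (rule finite_subset)
  show "finite ((\<lambda>x. THE F. min_poly_of F (qmap x)) ` exceptional)"
    using finite_exceptional by simp
  show "?S \<subseteq> (\<lambda>x. THE F. min_poly_of F (qmap x)) ` exceptional"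
  proof
    fix F
    assume "F \<in> ?S"
    then obtain r k where F: "lead_coeff F = 1" "irreducible F" and r: "lead_coeff r = 1" "irreducible r"
      and k: "k > 0" "k \<noteq> 1" and eq: "rat_transform F g h = (\<Prod>t\<in>star_orbit G r. t) ^ k"
      by blast
    obtain x where x: "min_poly_of r x"
      using ac_root_exists[OF irreducible_degree_pos[OF r(2)]] r by (auto simp: min_poly_of_def)
    have fin: "finite (star_orbit G r)"
    proof (rule ccontr)
      \<comment> \<open>A product over an infinite set is 1 by convention, whereas the transform has
        positive degree.\<close>
      assume "infinite (star_orbit G r)"
      then have "degree (rat_transform F g h) = 0"
        by (simp add: eq)
      then show False
        using transform_monic(1)[OF F(1)] quotient_facts(4) irreducible_degree_pos[OF F(2)] by simp
    qed
    have "ac_eval (rat_transform F g h) x = 0"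
      unfolding eq using fin star_orbit_self[OF x] x k(1)
      by (auto simp: min_poly_of_def intro!: prod_zero)
    then have "min_poly_of F (qmap x)"
      using transform_root_iff[OF F(1)] F by (simp add: min_poly_of_def)
    moreover from this have "x \<in> exceptional"
      using orbit_multiplicity_le_1[OF _ x _ eq] k by fastforce
    moreover have "(THE F. min_poly_of F (qmap x)) = F"
      using \<open>min_poly_of F (qmap x)\<close> min_poly_unique by blast
    ultimately show "F \<in> (\<lambda>x. THE F. min_poly_of F (qmap x)) ` exceptional"
      by blast
  qed
qed

end

theorem mainTheorem1:
  fixes G :: "('a::field ^ 2 ^ 2) set set" and g h :: "'a poly"
  assumes "subgroup G PGL2" and "finite G" and "quotient_map G g h"
  shows "(\<forall>F. lead_coeff F = 1 \<and> irreducible F \<longrightarrow>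
            (\<exists>r k. lead_coeff r = 1 \<and> irreducible r \<and> degree F dvd degree r \<and> (k::nat) > 0 \<and>
                   rat_transform F g h = (\<Prod>t\<in>star_orbit G r. t) ^ k))
       \<and> finite {F. lead_coeff F = 1 \<and> irreducible F \<and>
            (\<exists>r k. lead_coeff r = 1 \<and> irreducible r \<and> degree F dvd degree r \<and> (k::nat) > 0 \<and>
                   rat_transform F g h = (\<Prod>t\<in>star_orbit G r. t) ^ k \<and> k \<noteq> 1)}"
proof -
  interpret moebius_quotient G g h
    by (rule moebius_quotient.intro[OF assms])
  show ?thesis
    using transform_factorization finite_multiplicity_not_1 by blast
qed

end
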